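(* Fix integers $N\ge1$ and $K\ge0$, gauge couplings $g,g'$, a hypercharge $Y$ and a scalar potential $V(\Phi,s)$, and for each $d\in\mathbb{N}$ ($d\geq 1$) let $\mathcal{L}_d$ be the corresponding NHDM+KS Lagrangian in $d$ spacetime dimensions. Then the variational Lie point symmetries transforming only the scalars are the same for all $\mathcal{L}_d$, regardless of the spacetime dimension $d\in\mathbb{N}$. That is, for coefficient functions $\eta_i(\phi_1,\dots,\phi_{4N+K})$, $1\le i\le 4N+K$, the generator $X=\sum_i\eta_i\,\partial_{\phi_i}$ is a variational symmetry of $\mathcal{L}_d$ for one $d\in\mathbb{N}$ if and only if it is a variational symmetry of $\mathcal{L}_d$ for every $d\in\mathbb{N}$.
   Context: **NHDM+KS Lagrangian** ($N$ Higgs doublets and $K$ real scalar gauge singlets; $K=0$ means no singlets) in $d$ spacetime dimensions with coordinates $x_0,\dots,x_{d-1}$ and Minkowski metric: $$\mathcal{L}_d=\sum_{\mu=0}^{d-1}\Big(\sum_{n=1}^N(D_\mu\Phi_n)^\dagger D^\mu\Phi_n+\sum_{m=1}^K\tfrac12\,\partial_\mu s_m\,\partial^\mu s_m\Big)-V(\Phi,s)-\sum_{\mu,\nu=0}^{d-1}\Big(\tfrac14W^a_{\mu\nu}W^{a\mu\nu}+\tfrac14B_{\mu\nu}B^{\mu\nu}\Big),$$ where $\Phi=(\Phi_1,\dots,\Phi_N)$, $s=(s_1,\dots,s_K)$, the index $a$ is summed over $1,2,3$, and $$D_\mu=\partial_\mu+ig\tfrac{\sigma^a}{2}W^a_\mu+ig'YB_\mu,\quad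 W^a_{\mu\nu}=\partial_\mu W^a_\nu-\partial_\nu W^a_\mu+g\,\epsilon^{abc}W^b_\mu W^c_\nu,\quad B_{\mu\nu}=\partial_\mu B_\nu-\partial_\nu B_\mu,$$ $$\Phi_j=\frac1{\sqrt2}\begin{pmatrix}\phi_{4(j-1)+1}+i\phi_{4(j-1)+2}\\ \phi_{4(j-1)+3}+i\phi_{4(j-1)+4}\end{pmatrix},$$ with $\sigma^a$ the Pauli matrices. All $\phi_i$, $s_m$, $W^a_\mu$, $B_\mu$ are real fields (dependent variables). The potential $V$ is a real polynomial in the (undifferentiated) scalar fields; the same $V,g,g',Y$ are used for all $d$. We write $\phi_{4N+k}:=s_k$ for $1\le k\le K$. The dependent variables of $\mathcal{L}_d$ are the $4N+K$ scalars and the $4d$ gauge field components $W^a_\mu,B_\mu$. **Scalar generators.** Symmetries "transforming only the scalars" are generated by vector fields $X=\sum_{i=1}^{4N+K}\eta_i\,\partial_{\phi_i}$ with smooth $\eta_i=\eta_i(\phi_1,\dots,\phi_{4N+K})$; spacetime variables and gauge fields are not transformed. In dimension $d$ the first prolongation of $X$ is $$\operatorname{pr}^{(1)}X_d=\sum_i\eta_i\,\partial_{\phi_i}+\sum_{\mu=0}^{d-1}\sum_{i,j}\frac{\partial\phi_j}{\partial x_\mu}\frac{\partial\eta_i}{\partial\phi_j}\frac{\partial}{\partial(\partial\phi_i/\partial x_\mu)}.$$ **Variational symmetry.** $X$ is a variational symmetry of $\mathcal{L}_d$ if $\operatorname{pr}^{(1)}X_d(\mathcal{L}_d)=\sum_{\mu=0}^{d-1}\frac{d\beta^\mu}{dx^\mu}$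 identically (without assuming any field equations), for some local functions $\beta^\mu$ of the spacetime variables, the fields and finitely many derivatives of the fields; here $d/dx^\mu$ is the total derivative. The case $\beta^\mu=0$ for all $\mu$ (strict variational symmetry) is included. *)

theory Defs
  imports "HOL-Analysis.Analysis" "HOL-Library.Multiset" "HOL-Library.Groups_Big_Fun"
begin

definition depends_only_on :: "'c set \<Rightarrow> (('c \<Rightarrow> real) \<Rightarrow> real) \<Rightarrow> bool" where
  "depends_only_on S f \<longleftrightarrow> (\<forall>z z'. (\<forall>c\<in>S. z c = z' c) \<longrightarrow> f z = f z')"

definition pderiv_at :: "'c \<Rightarrow> (('c \<Rightarrow> real) \<Rightarrow> real) \<Rightarrow> ('c \<Rightarrow> real) \<Rightarrow> real" where
  "pderiv_at c f z = deriv (\<lambda>t. f (z(c := t))) (z c)"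

text \<open>All iterated partial derivatives exist and are continuous for the product topology.
  For a function depending on only finitely many coordinates, which is how the notion is used
  below, this is ordinary smoothness on a finite-dimensional space.\<close>

definition smooth :: "(('c \<Rightarrow> real) \<Rightarrow> real) \<Rightarrow> bool" where
  "smooth f \<longleftrightarrow> (\<forall>cs. continuous_on UNIV (foldr pderiv_at cs f) \<and>
     (\<forall>c z. (\<lambda>t. foldr pderiv_at cs f (z(c := t))) differentiable (at (z c))))"

definition real_polynomial_in :: "nat \<Rightarrow> ((nat \<Rightarrow> real) \<Rightarrow> real) \<Rightarrow> bool" where
  "real_polynomial_in n V \<longleftrightarrow>
     (\<exists>(M :: (nat \<Rightarrow> nat) set) c. finite M \<and>
        V = (\<lambda>\<phi>. \<Sum>m\<in>M. c m * (\<Prod>i=1..n. \<phi> i ^ m i)))"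

text \<open>The scalars are numbered from 1, with the doublet components
  in positions 1 to 4N and the singlets in positions 4N+1 to 4N+K. The first argument
  of \<open>WField\<close> is the isospin index in 1, 2, 3, the second one the spacetime index.\<close>

datatype dep_var = Scalar nat | WField nat nat | BField nat

text \<open>\<open>Jet v I\<close> is the coordinate for the derivative of \<open>v\<close> with respect to the spacetime
  variables in the multiset \<open>I\<close>, so mixed derivatives in different orders are identified.\<close>

datatype jet_coord = Pos nat | Jet dep_var "nat multiset"

type_synonym jet_fun = "(jet_coord \<Rightarrow> real) \<Rightarrow> real"

definition num_scalars :: "nat \<Rightarrow> nat \<Rightarrow> nat" where
  "num_scalars N K = 4 * N + K"

definition dep_vars :: "nat \<Rightarrow> nat \<Rightarrow> nat \<Rightarrow> dep_var set" where
  "dep_vars d N K =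
     Scalar ` {1..num_scalars N K} \<union> {WField a \<mu> | a \<mu>. a \<in> {1..3} \<and> \<mu> < d} \<union> BField ` {..<d}"

definition jet_coords :: "nat \<Rightarrow> nat \<Rightarrow> nat \<Rightarrow> jet_coord set" where
  "jet_coords d N K =
     Pos ` {..<d} \<union> {Jet v I | v I. v \<in> dep_vars d N K \<and> set_mset I \<subseteq> {..<d}}"

definition local_function :: "nat \<Rightarrow> nat \<Rightarrow> nat \<Rightarrow> jet_fun \<Rightarrow> bool" where
  "local_function d N K f \<longleftrightarrow>
     smooth f \<and> (\<exists>S. finite S \<and> S \<subseteq> jet_coords d N K \<and> depends_only_on S f)"

text \<open>For a local function only finitely many summands are nonzero.\<close>

definition total_deriv :: "nat \<Rightarrow> jet_fun \<Rightarrow> jet_fun" where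
  "total_deriv \<mu> f z = pderiv_at (Pos \<mu>) f z +
     Sum_any (\<lambda>(v, I). z (Jet v (add_mset \<mu> I)) * pderiv_at (Jet v I) f z)"

abbreviation scalar :: "(jet_coord \<Rightarrow> real) \<Rightarrow> nat \<Rightarrow> real" where
  "scalar z i \<equiv> z (Jet (Scalar i) {#})"

abbreviation dscalar :: "(jet_coord \<Rightarrow> real) \<Rightarrow> nat \<Rightarrow> nat \<Rightarrow> real" where
  "dscalar z \<mu> i \<equiv> z (Jet (Scalar i) {#\<mu>#})"

abbreviation W_val :: "(jet_coord \<Rightarrow> real) \<Rightarrow> nat \<Rightarrow> nat \<Rightarrow> real" where
  "W_val z a \<mu> \<equiv> z (Jet (WField a \<mu>) {#})"

abbreviation B_val :: "(jet_coord \<Rightarrow> real) \<Rightarrow> nat \<Rightarrow> real" where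
  "B_val z \<mu> \<equiv> z (Jet (BField \<mu>) {#})"

text \<open>Diagonal entries of the Minkowski metric, signature \<open>(+,-,\<dots>,-)\<close>; an index \<open>\<mu>\<close> is
  raised by multiplication with \<open>mink \<mu>\<close>.\<close>

definition mink :: "nat \<Rightarrow> real" where
  "mink \<mu> = (if \<mu> = 0 then 1 else - 1)"

definition pauli :: "nat \<Rightarrow> complex^2^2" where
  "pauli a =
     (if a = 1 then vector [vector [0, 1], vector [1, 0]]
      else if a = 2 then vector [vector [0, - \<i>], vector [\<i>, 0]]
      else vector [vector [1, 0], vector [0, - 1]])"

definition levi_civita :: "nat \<Rightarrow> nat \<Rightarrow> nat \<Rightarrow> real" where
  "levi_civita a b c =
     (if (a, b, c) \<in> {(1, 2, 3), (2, 3, 1), (3, 1, 2)} then 1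
      else if (a, b, c) \<in> {(1, 3, 2), (2, 1, 3), (3, 2, 1)} then - 1
      else 0)"

definition doublet :: "(nat \<Rightarrow> real) \<Rightarrow> nat \<Rightarrow> complex^2" where
  "doublet \<phi> j = (1 / complex_of_real (sqrt 2)) *s
     vector [Complex (\<phi> (4 * (j - 1) + 1)) (\<phi> (4 * (j - 1) + 2)),
             Complex (\<phi> (4 * (j - 1) + 3)) (\<phi> (4 * (j - 1) + 4))]"

definition cov_deriv ::
  "real \<Rightarrow> real \<Rightarrow> real \<Rightarrow> (jet_coord \<Rightarrow> real) \<Rightarrow> nat \<Rightarrow> nat \<Rightarrow> complex^2" where
  "cov_deriv g g' Y z \<mu> j =
     doublet (dscalar z \<mu>) j
     + (\<Sum>a=1..3. (\<i> * complex_of_real (g / 2 * W_val z a \<mu>)) *s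
                    (pauli a *v doublet (scalar z) j))
     + (\<i> * complex_of_real (g' * Y * B_val z \<mu>)) *s doublet (scalar z) j"

definition hermitian_prod :: "complex^2 \<Rightarrow> complex^2 \<Rightarrow> complex" where
  "hermitian_prod u v = (\<Sum>k\<in>UNIV. cnj (u $ k) * v $ k)"

definition W_strength :: "real \<Rightarrow> (jet_coord \<Rightarrow> real) \<Rightarrow> nat \<Rightarrow> nat \<Rightarrow> nat \<Rightarrow> real" where
  "W_strength g z a \<mu> \<nu> =
     z (Jet (WField a \<nu>) {#\<mu>#}) - z (Jet (WField a \<mu>) {#\<nu>#})
     + g * (\<Sum>b=1..3. \<Sum>c=1..3. levi_civita a b c * W_val z b \<mu> * W_val z c \<nu>)"

definition B_strength :: "(jet_coord \<Rightarrow> real) \<Rightarrow> nat \<Rightarrow> nat \<Rightarrow> real" where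
  "B_strength z \<mu> \<nu> = z (Jet (BField \<nu>) {#\<mu>#}) - z (Jet (BField \<mu>) {#\<nu>#})"

text \<open>The product \<open>hermitian_prod u u\<close> is real, so taking \<open>Re\<close> only changes the type.\<close>

lemma Im_hermitian_prod_self: "Im (hermitian_prod u u) = 0"
  by (simp add: hermitian_prod_def)

definition lagrangian ::
  "nat \<Rightarrow> nat \<Rightarrow> nat \<Rightarrow> real \<Rightarrow> real \<Rightarrow> real \<Rightarrow> ((nat \<Rightarrow> real) \<Rightarrow> real) \<Rightarrow> jet_fun" where
  "lagrangian d N K g g' Y V z =
     (\<Sum>\<mu><d.
        (\<Sum>n=1..N. mink \<mu> * Re (hermitian_prod (cov_deriv g g' Y z \<mu> n) (cov_deriv g g' Y z \<mu> n)))
        + (\<Sum>m=1..K. 1 / 2 * dscalar z \<mu> (4 * N + m) * (mink \<mu> * dscalar z \<mu> (4 * N + m))))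
     - V (scalar z)
     - (\<Sum>\<mu><d. \<Sum>\<nu><d.
          1 / 4 * (\<Sum>a=1..3. W_strength g z a \<mu> \<nu> * (mink \<mu> * mink \<nu> * W_strength g z a \<mu> \<nu>))
          + 1 / 4 * B_strength z \<mu> \<nu> * (mink \<mu> * mink \<nu> * B_strength z \<mu> \<nu>))"

text \<open>Values \<open>\<eta> i\<close> with \<open>i\<close> outside \<open>{1..n}\<close> are never
  used.\<close>

definition scalar_generator :: "nat \<Rightarrow> (nat \<Rightarrow> (nat \<Rightarrow> real) \<Rightarrow> real) \<Rightarrow> bool" where
  "scalar_generator n \<eta> \<longleftrightarrow> (\<forall>i\<in>{1..n}. smooth (\<eta> i) \<and> depends_only_on {1..n} (\<eta> i))"

definition prolongation ::
  "nat \<Rightarrow> nat \<Rightarrow> (nat \<Rightarrow> (nat \<Rightarrow> real) \<Rightarrow> real) \<Rightarrow> jet_fun \<Rightarrow> jet_fun" where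
  "prolongation d n \<eta> F z =
     (\<Sum>i=1..n. \<eta> i (scalar z) * pderiv_at (Jet (Scalar i) {#}) F z)
     + (\<Sum>\<mu><d. \<Sum>i=1..n. \<Sum>j=1..n.
          dscalar z \<mu> j * pderiv_at j (\<eta> i) (scalar z) * pderiv_at (Jet (Scalar i) {#\<mu>#}) F z)"

definition variational_symmetry ::
  "nat \<Rightarrow> nat \<Rightarrow> nat \<Rightarrow> real \<Rightarrow> real \<Rightarrow> real \<Rightarrow> ((nat \<Rightarrow> real) \<Rightarrow> real) \<Rightarrow>
   (nat \<Rightarrow> (nat \<Rightarrow> real) \<Rightarrow> real) \<Rightarrow> bool" where
  "variational_symmetry d N K g g' Y V \<eta> \<longleftrightarrow>
     (\<exists>\<beta>. (\<forall>\<mu><d. local_function d N K (\<beta> \<mu>)) \<and>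
          (\<forall>z. prolongation d (num_scalars N K) \<eta> (lagrangian d N K g g' Y V) z =
               (\<Sum>\<mu><d. total_deriv \<mu> (\<beta> \<mu>) z)))"

end

theory Submission
  imports Defs
begin

text \<open>The prolonged Lagrangian has the form
  \<open>Q = (\<Sum>\<mu><d. mink \<mu> * P(\<phi>, \<partial>\<^sub>\<mu>\<phi>, W\<^sub>\<mu>, B\<^sub>\<mu>)) - U(\<phi>)\<close>, where \<open>P\<close> and \<open>U\<close> do not
  depend on \<open>d\<close>, and \<open>P\<close> is even in its last three arguments and vanishes when they do. If \<open>Q\<close> is a
  divergence, the Euler operator annihilates it. For the gauge fields, which occur undifferentiated,
  this says that \<open>Q\<close> does not depend on them. For the scalars, the coefficients of the second derivatives
  with respect to \<open>x\<^sub>0\<close> show that \<open>Q\<close> is affine in the \<open>\<partial>\<^sub>0\<phi>\<^sub>i\<close>; an even affine function is constant, so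
  \<open>P = 0\<close>. Then the Euler-Lagrange equations of \<open>Q = - U(\<phi>)\<close> say that \<open>U\<close> is a constant \<open>k\<close>.
  Conversely, if \<open>P = 0\<close> and \<open>U = k\<close>, then in every dimension \<open>Q\<close> is the divergence of
  \<open>\<beta>\<^sup>0 = - k x\<^sub>0\<close>.\<close>

section \<open>Smooth functions of finitely many coordinates\<close>

lemma smooth_has_pderiv:
  assumes "smooth f"
  shows "((\<lambda>t. f (z(c := t))) has_real_derivative pderiv_at c f (z(c := x))) (at x)"
proof -
  have "(\<lambda>t. foldr pderiv_at [] f ((z(c := x))(c := t))) differentiable (at ((z(c := x)) c))"
    using assms unfolding smooth_def by blast
  then show ?thesis
    by (simp add: pderiv_at_def DERIV_deriv_iff_real_differentiable)
qed

lemma smooth_pderiv_at: "smooth f \<Longrightarrow> smooth (pderiv_at c f)"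
  unfolding smooth_def
proof (intro allI)
  fix cs
  assume *: "\<forall>cs. continuous_on UNIV (foldr pderiv_at cs f) \<and>
          (\<forall>c z. (\<lambda>t. foldr pderiv_at cs f (z(c := t))) differentiable at (z c))"
  show "continuous_on UNIV (foldr pderiv_at cs (pderiv_at c f)) \<and>
          (\<forall>ca z. (\<lambda>t. foldr pderiv_at cs (pderiv_at c f) (z(ca := t))) differentiable at (z ca))"
    using *[rule_format, of "cs @ [c]"] by simp
qed

lemma smooth_continuous: "smooth f \<Longrightarrow> continuous_on UNIV f"
  unfolding smooth_def by (metis foldr_Nil id_apply)

text \<open>Closure of \<open>X\<close> under \<open>pderiv_at\<close> keeps every iterated partial
  derivative in \<open>X\<close>, so continuity and differentiability need checking only for members
  of \<open>X\<close>. Smoothness thus reduces to finding a suitable class.\<close>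

lemma smooth_coinduct [consumes 1, case_names continuous differentiable pderiv]:
  assumes "X f"
    and cont: "\<And>f. X f \<Longrightarrow> continuous_on UNIV f"
    and diff: "\<And>f c z. X f \<Longrightarrow> (\<lambda>t. f (z(c := t))) differentiable (at (z c))"
    and pderiv: "\<And>f c. X f \<Longrightarrow> X (pderiv_at c f)"
  shows "smooth f"
proof -
  have "X (foldr pderiv_at cs f)" for cs
    by (induction cs) (auto simp: assms(1) pderiv)
  then show ?thesis
    unfolding smooth_def using cont diff by blast
qed

lemma pderiv_at_eqI:
  assumes "\<And>z. ((\<lambda>t. f (z(c := t))) has_real_derivative f' z) (at (z c))"
  shows "pderiv_at c f = f'"
  by (rule ext) (simp add: pderiv_at_def DERIV_imp_deriv[OF assms])

lemma smooth_has_pderiv_at: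
  assumes "smooth f"
  shows "((\<lambda>t. f (z(c := t))) has_real_derivative pderiv_at c f z) (at (z c))"
  using smooth_has_pderiv[OF assms, of z c "z c"] by simp

section \<open>Derivatives and smoothness of sums and products\<close>

lemma pderiv_at_add:
  assumes "smooth f" "smooth g"
  shows "pderiv_at c (\<lambda>z. f z + g z) = (\<lambda>z. pderiv_at c f z + pderiv_at c g z)"
  using assms by (intro pderiv_at_eqI DERIV_add smooth_has_pderiv_at)

lemma has_pderiv_at_mult:
  assumes "smooth f" "smooth g"
  shows "((\<lambda>t. f (z(c := t)) * g (z(c := t))) has_real_derivative
      pderiv_at c f z * g z + f z * pderiv_at c g z) (at (z c))"
  using DERIV_mult[OF smooth_has_pderiv_at smooth_has_pderiv_at, OF assms, of z c z c]
  by (simp add: algebra_simps)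

lemma pderiv_at_mult:
  assumes "smooth f" "smooth g"
  shows "pderiv_at c (\<lambda>z. f z * g z) = (\<lambda>z. pderiv_at c f z * g z + f z * pderiv_at c g z)"
  using assms by (intro pderiv_at_eqI has_pderiv_at_mult)

lemma pderiv_at_const [simp]: "pderiv_at c (\<lambda>_. k) = (\<lambda>_. 0)"
  by (rule pderiv_at_eqI) simp

lemma pderiv_at_coord: "pderiv_at c (\<lambda>z. z c') = (\<lambda>_. if c = c' then 1 else 0)"
  by (rule pderiv_at_eqI) auto

lemma smooth_const: "smooth (\<lambda>_. k)"
proof -
  have "\<exists>k'. (\<lambda>_. k') = ((\<lambda>_. k) :: ('a \<Rightarrow> real) \<Rightarrow> real)" by blast
  then show ?thesis
    by (rule smooth_coinduct[where X = "\<lambda>f. \<exists>k. (\<lambda>_. k) = f"]) auto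
qed

text \<open>The partial derivatives of a coordinate are the constants 0 and 1, so the coordinate
  together with all constants is a class closed under differentiation.\<close>

lemma smooth_coord: "smooth (\<lambda>z. z c)"
proof -
  have "(\<lambda>z. z c) = (\<lambda>z. z c) \<or> (\<exists>k. (\<lambda>_. k) = (\<lambda>z::'a \<Rightarrow> real. z c))" by blast
  then show ?thesis
  proof (rule smooth_coinduct[where X = "\<lambda>f. f = (\<lambda>z. z c) \<or> (\<exists>k. (\<lambda>_. k) = f)"], goal_cases)
    case (1 f)
    then show ?case by auto
  next
    case (2 f c' z)
    then show ?case by (cases "c = c'") auto
  next
    case (3 f c')
    then show ?case by (auto simp: pderiv_at_coord)
  qed
qed

text \<open>The product rule turns one product into a sum of two, so the coinduction for products
  needs a class that also contains sums. The factors in \<open>mult\<close> are required to be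
  smooth, hence so are the factors after differentiation.\<close>

inductive sum_of_smooth_products :: "(('c \<Rightarrow> real) \<Rightarrow> real) \<Rightarrow> bool" where
  base: "smooth f \<Longrightarrow> sum_of_smooth_products f"
| add: "sum_of_smooth_products f \<Longrightarrow> sum_of_smooth_products g \<Longrightarrow>
    sum_of_smooth_products (\<lambda>z. f z + g z)"
| mult: "smooth f \<Longrightarrow> smooth g \<Longrightarrow> sum_of_smooth_products (\<lambda>z. f z * g z)"

lemma sum_of_smooth_products_has_pderiv:
  assumes "sum_of_smooth_products f"
  shows "continuous_on UNIV f \<and> (\<exists>f'. sum_of_smooth_products f' \<and>
    (\<forall>z. ((\<lambda>t. f (z(c := t))) has_real_derivative f' z) (at (z c))))"
  using assms
proof induction
  case (base f)
  then show ?case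
    by (intro conjI exI[of _ "pderiv_at c f"] allI smooth_continuous smooth_has_pderiv_at
        sum_of_smooth_products.base smooth_pderiv_at)
next
  case (add f g)
  then obtain f' g' where *: "continuous_on UNIV f" "continuous_on UNIV g"
    "sum_of_smooth_products f'" "sum_of_smooth_products g'"
    "\<And>z. ((\<lambda>t. f (z(c := t))) has_real_derivative f' z) (at (z c))"
    "\<And>z. ((\<lambda>t. g (z(c := t))) has_real_derivative g' z) (at (z c))"
    by blast
  show ?case
    by (intro conjI exI[of _ "\<lambda>z. f' z + g' z"] allI continuous_on_add DERIV_add
        sum_of_smooth_products.add *)
next
  case (mult f g)
  have "sum_of_smooth_products (\<lambda>z. pderiv_at c f z * g z + f z * pderiv_at c g z)"
    using mult by (intro sum_of_smooth_products.intros smooth_pderiv_at)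
  then have "\<exists>f'. sum_of_smooth_products f' \<and>
     (\<forall>z. ((\<lambda>t. f (z(c := t)) * g (z(c := t))) has_real_derivative f' z) (at (z c)))"
    using has_pderiv_at_mult[OF mult] by blast
  then show ?case
    using continuous_on_mult[OF smooth_continuous smooth_continuous, OF mult] by blast
qed

lemma smooth_of_sum_of_products:
  assumes "sum_of_smooth_products f"
  shows "smooth f"
  using assms
proof (rule smooth_coinduct[where X = sum_of_smooth_products], goal_cases)
  case (1 f)
  then show ?case using sum_of_smooth_products_has_pderiv[OF 1] by simp
next
  case (2 f c z)
  then show ?case
    using sum_of_smooth_products_has_pderiv[OF 2, of c] unfolding real_differentiable_def by fast
next
  case (3 f c)
  obtain f' where f': "sum_of_smooth_products f'"
    "\<And>z. ((\<lambda>t. f (z(c := t))) has_real_derivative f' z) (at (z c))"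
    using sum_of_smooth_products_has_pderiv[OF 3, of c] by auto
  from f'(1) show ?case unfolding pderiv_at_eqI[OF f'(2)] .
qed

lemma smooth_add: "smooth f \<Longrightarrow> smooth g \<Longrightarrow> smooth (\<lambda>z. f z + g z)"
  by (rule smooth_of_sum_of_products, rule sum_of_smooth_products.add)
     (rule sum_of_smooth_products.base, assumption)+

lemma smooth_mult: "smooth f \<Longrightarrow> smooth g \<Longrightarrow> smooth (\<lambda>z. f z * g z)"
  by (rule smooth_of_sum_of_products, rule sum_of_smooth_products.mult)

section \<open>Symmetry of mixed partial derivatives\<close>

lemma second_difference_mean_value:
  fixes F :: "real \<Rightarrow> real \<Rightarrow> real"
  assumes h: "h > 0"
    and Fs: "\<And>s t. ((\<lambda>s. F s t) has_real_derivative Fs s t) (at s)"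
    and Fst: "\<And>s t. ((\<lambda>t. Fs s t) has_real_derivative Fst s t) (at t)"
  shows "\<exists>s t. a < s \<and> s < a + h \<and> b < t \<and> t < b + h \<and>
    F (a + h) (b + h) - F (a + h) b - F a (b + h) + F a b = h * h * Fst s t"
proof -
  have "\<exists>s>a. s < a + h \<and> (F (a + h) (b + h) - F (a + h) b) - (F a (b + h) - F a b)
      = (a + h - a) * (Fs s (b + h) - Fs s b)"
    \<comment> \<open>The mean value theorem is applied to \<open>F s (b + h) - F s b\<close> as a
      function of \<open>s\<close>, and afterwards to \<open>Fs s\<close> as a function of
      \<open>t\<close>.\<close>
    by (rule MVT2) (use h in \<open>auto intro!: DERIV_diff Fs\<close>)
  then obtain s where s: "a < s" "s < a + h"
    "F (a + h) (b + h) - F (a + h) b - F a (b + h) + F a b = h * (Fs s (b + h) - Fs s b)"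
    by (auto simp: algebra_simps)
  moreover have "\<exists>t>b. t < b + h \<and> Fs s (b + h) - Fs s b = (b + h - b) * Fst s t"
    by (rule MVT2) (use h in \<open>auto intro!: Fst\<close>)
  ultimately show ?thesis
    by (metis add_diff_cancel_left' mult.assoc)
qed

text \<open>Schwarz's theorem: the second difference over a small square equals \<open>h * h\<close>
  times either mixed derivative at some point of the square, and both mixed derivatives are
  continuous.\<close>

lemma pderiv_at_commute:
  assumes f: "smooth f"
  shows "pderiv_at c (pderiv_at c' f) = pderiv_at c' (pderiv_at c f)"
proof (cases "c = c'")
  case False
  show ?thesis
  proof
    fix z :: "'a \<Rightarrow> real"
    let ?z = "\<lambda>s t. z(c := s, c' := t)"
    let ?z' = "\<lambda>s t. z(c' := t, c := s)"
    have swap: "?z s t = ?z' s t" for s t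
      using False by (auto simp: fun_upd_twist)
    define F where "F s t = f (?z s t)" for s t
    define Fc where "Fc s t = pderiv_at c f (?z s t)" for s t
    define Fc' where "Fc' s t = pderiv_at c' f (?z s t)" for s t
    define G where "G s t = pderiv_at c' (pderiv_at c f) (?z s t)" for s t
    define G' where "G' s t = pderiv_at c (pderiv_at c' f) (?z s t)" for s t
    have d1: "((\<lambda>s. F s t) has_real_derivative Fc s t) (at s)"
      and d2: "((\<lambda>s. Fc' s t) has_real_derivative G' s t) (at s)"
      and d3: "((\<lambda>t. F s t) has_real_derivative Fc' s t) (at t)"
      and d4: "((\<lambda>t. Fc s t) has_real_derivative G s t) (at t)" for s t
      unfolding F_def Fc_def Fc'_def G_def G'_def
      by (simp_all only: smooth_has_pderiv smooth_pderiv_at f)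
         (simp_all only: smooth_has_pderiv smooth_pderiv_at f swap)
    have cz: "continuous_on UNIV (\<lambda>p. ?z (fst p) (snd p))"
    proof (rule continuous_on_coordinatewise_then_product)
      fix i
      show "continuous_on UNIV (\<lambda>p. ?z (fst p) (snd p) i)"
        by (cases "i = c"; cases "i = c'") (simp_all add: continuous_on_fst continuous_on_snd)
    qed
    have "continuous_on UNIV (\<lambda>p. pderiv_at a (pderiv_at b f) (?z (fst p) (snd p)))" for a b
      by (rule continuous_on_compose2[OF smooth_continuous cz])
         (simp_all add: smooth_pderiv_at f)
    then have contG: "isCont (\<lambda>p. G (fst p) (snd p)) q" and contG': "isCont (\<lambda>p. G' (fst p) (snd p)) q" for q
      unfolding G_def G'_def by (simp_all only: continuous_on_eq_continuous_at[OF open_UNIV] UNIV_I ball_UNIV)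
    let ?q = "(z c, z c')"
    have "\<bar>G (z c) (z c') - G' (z c) (z c')\<bar> < e" if e: "e > 0" for e
    proof -
      obtain r where r: "r > 0" "\<And>p. dist p ?q < r \<Longrightarrow> \<bar>G (fst p) (snd p) - G (z c) (z c')\<bar> < e / 2"
        using contG[of ?q] e unfolding continuous_at_eps_delta dist_real_def
        by (metis fst_conv half_gt_zero snd_conv)
      obtain r' where r': "r' > 0" "\<And>p. dist p ?q < r' \<Longrightarrow> \<bar>G' (fst p) (snd p) - G' (z c) (z c')\<bar> < e / 2"
        using contG'[of ?q] e unfolding continuous_at_eps_delta dist_real_def
        by (metis fst_conv half_gt_zero snd_conv)
      \<comment> \<open>Points of the open square of side \<open>h\<close> are closer than
        \<open>2 * h\<close> to its corner, hence lie in both neighbourhoods.\<close>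
      define h where "h = min r r' / 2"
      have h: "h > 0" "2 * h \<le> r" "2 * h \<le> r'" using r(1) r'(1) by (auto simp: h_def)
      have near: "dist (s, t) ?q < 2 * h"
        if "z c < s" "s < z c + h" "z c' < t" "t < z c' + h" for s t
      proof -
        have "dist (s, t) ?q \<le> \<bar>s - z c\<bar> + \<bar>t - z c'\<bar>"
          using sqrt_sum_squares_le_sum_abs by (simp add: dist_Pair_Pair dist_real_def) 
        then show ?thesis using that by linarith
      qed
      obtain s t where st: "dist (s, t) ?q < 2 * h"
        "F (z c + h) (z c' + h) - F (z c + h) (z c') - F (z c) (z c' + h) + F (z c) (z c') = h * h * G s t"
        using second_difference_mean_value[OF h(1), of F Fc G "z c" "z c'", OF d1 d4] near by metis
      \<comment> \<open>Exchanging the roles of the two coordinates leaves the second difference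
        unchanged but produces the other mixed derivative.\<close>
      obtain t' s' where st': "dist (s', t') ?q < 2 * h"
        "F (z c + h) (z c' + h) - F (z c) (z c' + h) - F (z c + h) (z c') + F (z c) (z c') = h * h * G' s' t'"
        using second_difference_mean_value[OF h(1), of "\<lambda>t s. F s t" "\<lambda>t s. Fc' s t" "\<lambda>t s. G' s t" "z c'" "z c", OF d3 d2] near
        by metis
      have "G s t = G' s' t'" using st(2) st'(2) h(1) by (auto simp: algebra_simps)
      then show ?thesis
        using r(2)[of "(s, t)"] r'(2)[of "(s', t')"] st(1) st'(1) h
        by (simp only: fst_conv snd_conv) linarith
    qed
    then have "G (z c) (z c') = G' (z c) (z c')"
      by (metis abs_0_eq abs_ge_zero eq_iff_diff_eq_0 less_irrefl order_le_less)
    then show "pderiv_at c (pderiv_at c' f) z = pderiv_at c' (pderiv_at c f) z"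
      by (simp add: G_def G'_def)
  qed
qed simp

section \<open>Dependence on finitely many coordinates\<close>

lemma depends_only_on_pderiv_at:
  assumes "depends_only_on S f"
  shows "depends_only_on S (pderiv_at c f)" and "c \<notin> S \<Longrightarrow> pderiv_at c f = (\<lambda>_. 0)"
proof -
  have const: "f (z(c := t)) = f z" if "c \<notin> S" for z t
    using assms that unfolding depends_only_on_def by (metis fun_upd_other)
  then show 0: "pderiv_at c f = (\<lambda>_. 0)" if "c \<notin> S"
    using that by (auto simp: pderiv_at_def)
  show "depends_only_on S (pderiv_at c f)"
  proof (cases "c \<in> S")
    case True
    show ?thesis unfolding depends_only_on_def
    proof (intro allI impI)
      fix z z' :: "'a \<Rightarrow> real" assume *: "\<forall>c\<in>S. z c = z' c"
      then have "f (z(c := t)) = f (z'(c := t))" for t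
        using assms unfolding depends_only_on_def by auto
      then show "pderiv_at c f z = pderiv_at c f z'"
        using * True by (simp add: pderiv_at_def)
    qed
  qed (use 0 in \<open>simp add: depends_only_on_def\<close>)
qed

lemma pderiv_at_zero_imp_upd_eq:
  assumes "smooth f" "pderiv_at c f = (\<lambda>_. 0)"
  shows "f (z(c := t)) = f z"
proof -
  have "f (z(c := t)) = f (z(c := z c))"
    by (rule DERIV_isconst_all[of "\<lambda>t. f (z(c := t))"])
       (use smooth_has_pderiv[OF assms(1), of z c] assms(2) in simp)
  then show ?thesis by simp
qed

text \<open>This is \<open>local_function\<close> for an arbitrary coordinate type, with no
  restriction on which coordinates occur; the calculus below needs only finiteness.\<close>

definition finitary_smooth :: "(('c \<Rightarrow> real) \<Rightarrow> real) \<Rightarrow> bool" where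
  "finitary_smooth f \<longleftrightarrow> smooth f \<and> (\<exists>S. finite S \<and> depends_only_on S f)"

lemma finitary_smooth_imp_smooth: "finitary_smooth f \<Longrightarrow> smooth f"
  by (simp add: finitary_smooth_def)

lemma finitary_smooth_pderiv_at: "finitary_smooth f \<Longrightarrow> finitary_smooth (pderiv_at c f)"
  by (meson depends_only_on_pderiv_at(1) finitary_smooth_def smooth_pderiv_at)

lemma finitary_smooth_const: "finitary_smooth (\<lambda>_. k)"
  by (auto simp: finitary_smooth_def smooth_const depends_only_on_def)

lemma finitary_smooth_coord: "finitary_smooth (\<lambda>z. z c)"
  unfolding finitary_smooth_def depends_only_on_def by (auto simp: smooth_coord intro!: exI[of _ "{c}"])

lemma depends_only_on_binop:
  assumes "depends_only_on S f" "depends_only_on T g"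
  shows "depends_only_on (S \<union> T) (\<lambda>z. h (f z) (g z))"
  using assms unfolding depends_only_on_def by (metis UnCI)

lemma finitary_smooth_add:
  assumes "finitary_smooth f" "finitary_smooth g"
  shows "finitary_smooth (\<lambda>z. f z + g z)"
proof -
  obtain S T where "finite S" "finite T" "depends_only_on S f" "depends_only_on T g"
    using assms by (auto simp: finitary_smooth_def)
  then have "finite (S \<union> T)" "depends_only_on (S \<union> T) (\<lambda>z. f z + g z)"
    by (simp_all add: depends_only_on_binop)
  then show ?thesis
    unfolding finitary_smooth_def using smooth_add assms finitary_smooth_imp_smooth by blast
qed

lemma finitary_smooth_mult:
  assumes "finitary_smooth f" "finitary_smooth g"
  shows "finitary_smooth (\<lambda>z. f z * g z)"
proof -
  obtain S T where "finite S" "finite T" "depends_only_on S f" "depends_only_on T g"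
    using assms by (auto simp: finitary_smooth_def)
  then have "finite (S \<union> T)" "depends_only_on (S \<union> T) (\<lambda>z. f z * g z)"
    by (simp_all add: depends_only_on_binop)
  then show ?thesis
    unfolding finitary_smooth_def using smooth_mult assms finitary_smooth_imp_smooth by blast
qed

lemma finitary_smooth_minus: "finitary_smooth f \<Longrightarrow> finitary_smooth (\<lambda>z. - f z)"
  using finitary_smooth_mult[OF finitary_smooth_const[of "-1"], of f] by simp

lemma finitary_smooth_sum:
  "(\<And>a. a \<in> A \<Longrightarrow> finitary_smooth (f a)) \<Longrightarrow> finitary_smooth (\<lambda>z. \<Sum>a\<in>A. f a z)"
  by (induction A rule: infinite_finite_induct)
     (auto simp: finitary_smooth_const finitary_smooth_add)

lemmas finitary_smooth_intros =
  finitary_smooth_pderiv_at finitary_smooth_const finitary_smooth_coord finitary_smooth_add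
  finitary_smooth_mult finitary_smooth_minus finitary_smooth_sum

lemma pderiv_at_sum:
  assumes "finite A" "\<And>a. a \<in> A \<Longrightarrow> finitary_smooth (f a)"
  shows "pderiv_at c (\<lambda>z. \<Sum>a\<in>A. f a z) = (\<lambda>z. \<Sum>a\<in>A. pderiv_at c (f a) z)"
  using assms(2) by (intro pderiv_at_eqI DERIV_sum)
    (auto intro: smooth_has_pderiv_at finitary_smooth_imp_smooth)

text \<open>Only the finitely many coordinates in \<open>S \<inter> T\<close> have to be changed
  from \<open>z\<close> to \<open>z'\<close>, and they can be changed one at a time, each without
  effect on \<open>f\<close>.\<close>

lemma eq_if_pderivs_zero:
  assumes f: "finitary_smooth f"
    and T: "\<And>c. c \<in> T \<Longrightarrow> pderiv_at c f = (\<lambda>_. 0)"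
    and z: "\<And>c. c \<notin> T \<Longrightarrow> z c = z' c"
  shows "f z = f z'"
proof -
  obtain S where S: "finite S" "depends_only_on S f" and sm: "smooth f"
    using f by (auto simp: finitary_smooth_def)
  have "f (override_on z z' A) = f z" if "A \<subseteq> T" "finite A" for A
    using that(2,1)
  proof (induction A)
    case (insert c A)
    have "override_on z z' (insert c A) = (override_on z z' A)(c := z' c)"
      by (auto simp: override_on_def)
    then show ?case
      using insert pderiv_at_zero_imp_upd_eq[OF sm T] by (simp del: fun_upd_apply)
  qed simp
  then have "f (override_on z z' (S \<inter> T)) = f z" using S by simp
  moreover have "\<forall>c\<in>S. override_on z z' (S \<inter> T) c = z' c"
    using z by (auto simp: override_on_def)
  then have "f (override_on z z' (S \<inter> T)) = f z'"
    using S(2) unfolding depends_only_on_def by blast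
  ultimately show ?thesis by simp
qed

text \<open>Midpoint form of being affine in the coordinates of \<open>T\<close>. Subtracting the
  linear part leaves \<open>g\<close>, which is constant along \<open>T\<close>; the coefficients
  \<open>pderiv_at c f\<close> are also constant along \<open>T\<close>, so the linear parts at the
  two opposite points cancel.\<close>

lemma affine_if_second_pderivs_zero:
  assumes f: "finitary_smooth f"
    and T: "\<And>c c'. c \<in> T \<Longrightarrow> c' \<in> T \<Longrightarrow> pderiv_at c (pderiv_at c' f) = (\<lambda>_. 0)"
  shows "f z + f (\<lambda>c. if c \<in> T then - z c else z c) = 2 * f (\<lambda>c. if c \<in> T then 0 else z c)"
proof -
  obtain S where S: "finite S" "depends_only_on S f"
    using f by (auto simp: finitary_smooth_def)
  have fin: "finite (S \<inter> T)" using S by simp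
  define g where "g = (\<lambda>z. f z + - (\<Sum>c\<in>S \<inter> T. z c * pderiv_at c f z))"
  let ?n = "\<lambda>c. if c \<in> T then - z c else z c"
  let ?o = "\<lambda>c. if c \<in> T then 0 else z c"
  have sg: "finitary_smooth g"
    unfolding g_def by (intro finitary_smooth_intros f)
  have "pderiv_at c g = (\<lambda>_. 0)" if c: "c \<in> T" for c
  proof
    fix z
    have "((\<lambda>t. \<Sum>x\<in>S \<inter> T. (z(c := t)) x * pderiv_at x f (z(c := t))) has_real_derivative
         (\<Sum>x\<in>S \<inter> T. if c = x then pderiv_at c f z else 0)) (at (z c))"
    proof (rule DERIV_sum)
      fix x assume "x \<in> S \<inter> T"
      then have "pderiv_at c (\<lambda>z. z x * pderiv_at x f z) = (\<lambda>z. if c = x then pderiv_at c f z else 0)"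
        using T[OF c] f
        by (auto simp: pderiv_at_mult smooth_coord smooth_pderiv_at finitary_smooth_imp_smooth pderiv_at_coord)
      then show "((\<lambda>t. (z(c := t)) x * pderiv_at x f (z(c := t))) has_real_derivative
          (if c = x then pderiv_at c f z else 0)) (at (z c))"
        using smooth_has_pderiv_at[of "\<lambda>z. z x * pderiv_at x f z" z c]
          smooth_mult[OF smooth_coord smooth_pderiv_at[OF finitary_smooth_imp_smooth[OF f]]]
        by simp
    qed
    \<comment> \<open>If \<open>c \<notin> S\<close>, the sum has no term for \<open>c\<close>, but
      then \<open>pderiv_at c f\<close> vanishes as well.\<close>
    moreover have "(\<Sum>x\<in>S \<inter> T. if c = x then pderiv_at c f z else 0) = pderiv_at c f z"
      using depends_only_on_pderiv_at(2)[OF S(2), of c] fin c by (auto simp: sum.delta)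
    ultimately have "((\<lambda>t. g (z(c := t))) has_real_derivative pderiv_at c f z + - pderiv_at c f z) (at (z c))"
      unfolding g_def
      by (intro DERIV_add DERIV_minus smooth_has_pderiv_at finitary_smooth_imp_smooth f) simp
    then show "pderiv_at c g z = 0"
      by (simp add: pderiv_at_def DERIV_imp_deriv)
  qed
  note g0 = eq_if_pderivs_zero[where T = T, OF sg this]
  have g: "g z = g ?o" "g ?n = g ?o"
    by (rule g0; auto)+
  note f0 = eq_if_pderivs_zero[OF finitary_smooth_pderiv_at[OF f] T]
  have "pderiv_at c f z = pderiv_at c f ?o" "pderiv_at c f ?n = pderiv_at c f ?o" if "c \<in> T" for c
    by (rule f0[OF _ that]; auto)+
  then have "(\<Sum>c\<in>S \<inter> T. ?n c * pderiv_at c f ?n) = - (\<Sum>c\<in>S \<inter> T. z c * pderiv_at c f z)"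
    "(\<Sum>c\<in>S \<inter> T. ?o c * pderiv_at c f ?o) = 0"
    unfolding sum_negf[symmetric] by (auto intro!: sum.cong)
  then show ?thesis
    using g by (simp add: g_def)
qed

section \<open>Total derivatives and the Euler operator\<close>

definition jet_support :: "jet_fun \<Rightarrow> (dep_var \<times> nat multiset) set" where
  "jet_support f = {(v, I). pderiv_at (Jet v I) f \<noteq> (\<lambda>_. 0)}"

lemma finite_jet_support:
  assumes "finitary_smooth f"
  shows "finite (jet_support f)"
proof -
  obtain S where S: "finite S" "depends_only_on S f"
    using assms by (auto simp: finitary_smooth_def)
  have "inj_on (\<lambda>(v, I). Jet v I) (jet_support f)"
    by (auto simp: inj_on_def)
  moreover have "(\<lambda>(v, I). Jet v I) ` jet_support f \<subseteq> S"
    using depends_only_on_pderiv_at(2)[OF S(2)] by (auto simp: jet_support_def)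
  ultimately show ?thesis
    using S(1) by (metis finite_imageD finite_subset)
qed

text \<open>Allowing any finite superset of the support lets several functions be expanded over one
  common index set.\<close>

lemma total_deriv_eq:
  assumes "finite A" "jet_support f \<subseteq> A"
  shows "total_deriv \<mu> f = (\<lambda>z. pderiv_at (Pos \<mu>) f z +
    (\<Sum>(v, I)\<in>A. z (Jet v (add_mset \<mu> I)) * pderiv_at (Jet v I) f z))"
proof
  fix z
  have "Sum_any (\<lambda>(v, I). z (Jet v (add_mset \<mu> I)) * pderiv_at (Jet v I) f z) =
    (\<Sum>(v, I)\<in>A. z (Jet v (add_mset \<mu> I)) * pderiv_at (Jet v I) f z)"
    using assms by (intro Sum_any.expand_superset) (auto simp: jet_support_def)
  then show "total_deriv \<mu> f z = pderiv_at (Pos \<mu>) f z +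
    (\<Sum>(v, I)\<in>A. z (Jet v (add_mset \<mu> I)) * pderiv_at (Jet v I) f z)"
    by (simp add: total_deriv_def)
qed

lemma finitary_smooth_total_deriv:
  assumes "finitary_smooth f"
  shows "finitary_smooth (total_deriv \<mu> f)"
  unfolding total_deriv_eq[OF finite_jet_support[OF assms] order_refl] split_def
  by (intro finitary_smooth_intros assms)

lemma total_deriv_add:
  assumes f: "finitary_smooth f" and g: "finitary_smooth g"
  shows "total_deriv \<mu> (\<lambda>z. f z + g z) = (\<lambda>z. total_deriv \<mu> f z + total_deriv \<mu> g z)"
proof -
  let ?A = "jet_support f \<union> jet_support g \<union> jet_support (\<lambda>z. f z + g z)"
  have A: "finite ?A"
    using f g by (simp add: finite_jet_support finitary_smooth_add)
  show ?thesis
    by (simp add: total_deriv_eq[OF A] le_supI1 le_supI2 pderiv_at_add f g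
        finitary_smooth_imp_smooth sum.distrib[symmetric] split_def algebra_simps)
qed

lemma total_deriv_mult:
  assumes f: "finitary_smooth f" and g: "finitary_smooth g"
  shows "total_deriv \<mu> (\<lambda>z. f z * g z) = (\<lambda>z. total_deriv \<mu> f z * g z + f z * total_deriv \<mu> g z)"
proof -
  let ?A = "jet_support f \<union> jet_support g \<union> jet_support (\<lambda>z. f z * g z)"
  have A: "finite ?A"
    using f g by (simp add: finite_jet_support finitary_smooth_mult)
  show ?thesis
    by (simp add: total_deriv_eq[OF A] le_supI1 le_supI2 pderiv_at_mult f g
        finitary_smooth_imp_smooth sum.distrib sum_distrib_left sum_distrib_right split_def algebra_simps)
qed

lemma total_deriv_const: "total_deriv \<mu> (\<lambda>_. k) = (\<lambda>_. 0)"
  using total_deriv_eq[of "{}" "\<lambda>_. k" \<mu>] by (simp add: jet_support_def)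

lemma total_deriv_minus:
  assumes "finitary_smooth f"
  shows "total_deriv \<mu> (\<lambda>z. - f z) = (\<lambda>z. - total_deriv \<mu> f z)"
  using total_deriv_mult[OF finitary_smooth_const[of "-1"] assms, of \<mu>]
  by (simp add: total_deriv_const)

lemma total_deriv_sum:
  assumes "\<And>a. a \<in> A \<Longrightarrow> finitary_smooth (f a)"
  shows "total_deriv \<mu> (\<lambda>z. \<Sum>a\<in>A. f a z) = (\<lambda>z. \<Sum>a\<in>A. total_deriv \<mu> (f a) z)"
  using assms
  by (induction A rule: infinite_finite_induct)
     (simp_all add: total_deriv_const total_deriv_add finitary_smooth_sum)

lemma total_deriv_Jet: "total_deriv \<mu> (\<lambda>z. z (Jet v I)) = (\<lambda>z. z (Jet v (add_mset \<mu> I)))"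
proof -
  have "jet_support (\<lambda>z. z (Jet v I)) \<subseteq> {(v, I)}"
    by (auto simp: jet_support_def pderiv_at_coord split: if_splits)
  from total_deriv_eq[OF _ this] show ?thesis
    by (simp add: pderiv_at_coord)
qed

lemma total_deriv_Pos: "total_deriv \<mu> (\<lambda>z. z (Pos \<nu>)) = (\<lambda>z. if \<mu> = \<nu> then 1 else 0)"
proof -
  have "jet_support (\<lambda>z. z (Pos \<nu>)) \<subseteq> {}"
    by (auto simp: jet_support_def pderiv_at_coord)
  from total_deriv_eq[OF _ this] show ?thesis
    by (auto simp: pderiv_at_coord)
qed

text \<open>The factors \<open>z (Jet v (add_mset \<mu> I))\<close> in the total derivative are
  coordinates themselves. Differentiating them gives the extra sum; symmetry of second derivatives
  identifies the rest with the total derivative of \<open>pderiv_at c f\<close>.\<close>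

lemma pderiv_at_total_deriv:
  assumes f: "finitary_smooth f" and A: "finite A" "jet_support f \<subseteq> A" "jet_support (pderiv_at c f) \<subseteq> A"
  shows "pderiv_at c (total_deriv \<mu> f) = (\<lambda>z. total_deriv \<mu> (pderiv_at c f) z +
    (\<Sum>(v, I)\<in>A. if c = Jet v (add_mset \<mu> I) then pderiv_at (Jet v I) f z else 0))"
proof -
  let ?g = "\<lambda>p z. z (Jet (fst p) (add_mset \<mu> (snd p))) * pderiv_at (Jet (fst p) (snd p)) f z"
  have g: "finitary_smooth (?g p)" for p
    by (intro finitary_smooth_intros f)
  have "pderiv_at c (?g p) = (\<lambda>z. (if c = Jet (fst p) (add_mset \<mu> (snd p)) then pderiv_at (Jet (fst p) (snd p)) f z else 0)
     + z (Jet (fst p) (add_mset \<mu> (snd p))) * pderiv_at (Jet (fst p) (snd p)) (pderiv_at c f) z)" for p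
    using pderiv_at_mult[OF smooth_coord smooth_pderiv_at[OF finitary_smooth_imp_smooth[OF f]],
        of c "Jet (fst p) (add_mset \<mu> (snd p))" "Jet (fst p) (snd p)"]
      pderiv_at_commute[OF finitary_smooth_imp_smooth[OF f], of c "Jet (fst p) (snd p)"]
    by (auto simp: pderiv_at_coord)
  then have "pderiv_at c (\<lambda>z. \<Sum>p\<in>A. ?g p z) =
      (\<lambda>z. \<Sum>p\<in>A. (if c = Jet (fst p) (add_mset \<mu> (snd p)) then pderiv_at (Jet (fst p) (snd p)) f z else 0)
     + z (Jet (fst p) (add_mset \<mu> (snd p))) * pderiv_at (Jet (fst p) (snd p)) (pderiv_at c f) z)"
    using pderiv_at_sum[OF A(1) g] by simp
  moreover have "smooth (\<lambda>z. \<Sum>p\<in>A. ?g p z)"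
    using g by (intro finitary_smooth_imp_smooth finitary_smooth_sum)
  ultimately show ?thesis
    unfolding total_deriv_eq[OF A(1,2)] total_deriv_eq[OF A(1,3)] split_def
    by (simp add: pderiv_at_add smooth_pderiv_at finitary_smooth_imp_smooth f sum.distrib
        pderiv_at_commute[of f c "Pos \<mu>"] algebra_simps)
qed

lemma pderiv_at_Pos_total_deriv:
  assumes f: "finitary_smooth f"
  shows "pderiv_at (Pos \<nu>) (total_deriv \<mu> f) = total_deriv \<mu> (pderiv_at (Pos \<nu>) f)"
  using f
  by (subst pderiv_at_total_deriv[OF f, of "jet_support f \<union> jet_support (pderiv_at (Pos \<nu>) f)"])
     (auto simp: finite_jet_support finitary_smooth_pderiv_at)

text \<open>At most one index \<open>J\<close> satisfies \<open>I = add_mset \<mu> J\<close>, so at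
  most one correction term survives. The condition \<open>\<mu> \<in># I\<close> is essential,
  because multiset subtraction returns \<open>I\<close> when \<open>\<mu>\<close> is absent.\<close>

lemma pderiv_at_Jet_total_deriv:
  assumes f: "finitary_smooth f"
  shows "pderiv_at (Jet v I) (total_deriv \<mu> f) = (\<lambda>z. total_deriv \<mu> (pderiv_at (Jet v I) f) z +
    (if \<mu> \<in># I then pderiv_at (Jet v (I - {#\<mu>#})) f z else 0))"
proof -
  \<comment> \<open>The index of the surviving term is adjoined so that the sum over
    \<open>A\<close> is sure to contain it.\<close>
  define A where "A = insert (v, I - {#\<mu>#}) (jet_support f \<union> jet_support (pderiv_at (Jet v I) f))"
  have A: "finite A" "jet_support f \<subseteq> A" "jet_support (pderiv_at (Jet v I) f) \<subseteq> A"
    using f by (auto simp: A_def finite_jet_support finitary_smooth_pderiv_at)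
  have eq: "(Jet v I = Jet (fst p) (add_mset \<mu> (snd p))) = (\<mu> \<in># I \<and> p = (v, I - {#\<mu>#}))" for p
    by (cases p) (auto simp: insert_DiffM)
  have "(\<Sum>(w, J)\<in>A. if Jet v I = Jet w (add_mset \<mu> J) then pderiv_at (Jet w J) f z else 0) =
    (if \<mu> \<in># I then pderiv_at (Jet v (I - {#\<mu>#})) f z else 0)" for z
  proof -
    have "(\<Sum>(w, J)\<in>A. if Jet v I = Jet w (add_mset \<mu> J) then pderiv_at (Jet w J) f z else 0) =
      (\<Sum>p\<in>A. if p = (v, I - {#\<mu>#}) then (if \<mu> \<in># I then pderiv_at (Jet v (I - {#\<mu>#})) f z else 0) else 0)"
      unfolding split_def eq by (intro sum.cong) auto
    also have "\<dots> = (if \<mu> \<in># I then pderiv_at (Jet v (I - {#\<mu>#})) f z else 0)"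
      using A(1) by (subst sum.delta) (auto simp: A_def)
    finally show ?thesis .
  qed
  then show ?thesis
    using pderiv_at_total_deriv[OF f A] by simp
qed

text \<open>One side is expanded by the commutation rules above, the other by the product rule. They
  differ only in how the terms with coordinates raised by both \<open>\<mu>\<close> and
  \<open>\<nu>\<close> are indexed, and \<open>I \<mapsto> add_mset \<nu> I\<close> matches
  these.\<close>

lemma total_deriv_commute:
  assumes f: "finitary_smooth f"
  shows "total_deriv \<mu> (total_deriv \<nu> f) = total_deriv \<nu> (total_deriv \<mu> f)"
proof -
  let ?ins = "\<lambda>(v, I). (v, add_mset \<nu> I)"
  let ?D = "\<lambda>p. pderiv_at (Jet (fst p) (snd p)) f"
  define A where "A = jet_support f \<union> jet_support (total_deriv \<nu> f) \<union> ?ins ` jet_support f"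
  have A: "finite A" "jet_support f \<subseteq> A" "jet_support (total_deriv \<nu> f) \<subseteq> A"
    using f by (auto simp: A_def finite_jet_support finitary_smooth_total_deriv)
  show ?thesis
  proof
    fix z
    have lhs: "total_deriv \<mu> (total_deriv \<nu> f) z = total_deriv \<nu> (pderiv_at (Pos \<mu>) f) z +
      ((\<Sum>p\<in>A. z (Jet (fst p) (add_mset \<mu> (snd p))) * total_deriv \<nu> (?D p) z) +
       (\<Sum>p\<in>A. if \<nu> \<in># snd p then z (Jet (fst p) (add_mset \<mu> (snd p))) *
             pderiv_at (Jet (fst p) (snd p - {#\<nu>#})) f z else 0))"
      unfolding total_deriv_eq[OF A(1,3), of \<mu>] split_def
      by (auto simp: pderiv_at_Jet_total_deriv pderiv_at_Pos_total_deriv f algebra_simps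
          sum.distrib[symmetric] intro!: sum.cong)
    have "finitary_smooth (\<lambda>z. \<Sum>p\<in>A. z (Jet (fst p) (add_mset \<mu> (snd p))) * ?D p z)"
      by (intro finitary_smooth_intros f)
    then have rhs: "total_deriv \<nu> (total_deriv \<mu> f) z = total_deriv \<nu> (pderiv_at (Pos \<mu>) f) z +
      (\<Sum>p\<in>A. z (Jet (fst p) (add_mset \<nu> (add_mset \<mu> (snd p)))) * ?D p z +
         z (Jet (fst p) (add_mset \<mu> (snd p))) * total_deriv \<nu> (?D p) z)"
      unfolding total_deriv_eq[OF A(1,2), of \<mu>] split_def
      by (simp add: total_deriv_add total_deriv_sum total_deriv_mult finitary_smooth_intros f total_deriv_Jet)
    have "(\<Sum>p\<in>A. if \<nu> \<in># snd p then z (Jet (fst p) (add_mset \<mu> (snd p))) *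
             pderiv_at (Jet (fst p) (snd p - {#\<nu>#})) f z else 0)
       = (\<Sum>p\<in>?ins ` jet_support f. z (Jet (fst p) (add_mset \<mu> (snd p))) *
             pderiv_at (Jet (fst p) (snd p - {#\<nu>#})) f z)"
    proof (rule sum.mono_neutral_cong_right)
      show "\<forall>p\<in>A - ?ins ` jet_support f. (if \<nu> \<in># snd p then z (Jet (fst p) (add_mset \<mu> (snd p))) *
             pderiv_at (Jet (fst p) (snd p - {#\<nu>#})) f z else 0) = 0"
      proof
        fix p assume p: "p \<in> A - ?ins ` jet_support f"
        have "(fst p, snd p - {#\<nu>#}) \<notin> jet_support f" if "\<nu> \<in># snd p"
          using p that by (auto simp: image_iff split_def insert_DiffM prod_eq_iff)
        then show "(if \<nu> \<in># snd p then z (Jet (fst p) (add_mset \<mu> (snd p))) *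
             pderiv_at (Jet (fst p) (snd p - {#\<nu>#})) f z else 0) = 0"
          by (auto simp: jet_support_def)
      qed
    qed (use A in \<open>auto simp: A_def\<close>)
    also have "\<dots> = (\<Sum>p\<in>jet_support f. z (Jet (fst p) (add_mset \<nu> (add_mset \<mu> (snd p)))) * ?D p z)"
      by (subst sum.reindex) (auto simp: inj_on_def split_def add_mset_commute intro!: sum.cong)
    also have "\<dots> = (\<Sum>p\<in>A. z (Jet (fst p) (add_mset \<nu> (add_mset \<mu> (snd p)))) * ?D p z)"
      by (intro sum.mono_neutral_left) (use A in \<open>auto simp: jet_support_def\<close>)
    finally show "total_deriv \<mu> (total_deriv \<nu> f) z = total_deriv \<nu> (total_deriv \<mu> f) z"
      unfolding lhs rhs by (simp add: sum.distrib)
  qed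
qed

section \<open>Formal adjoints of iterated total derivatives\<close>

definition neg_total_deriv :: "nat \<Rightarrow> jet_fun \<Rightarrow> jet_fun" where
  "neg_total_deriv \<mu> f = (\<lambda>z. - total_deriv \<mu> f z)"

lemma finitary_smooth_neg_total_deriv:
  "finitary_smooth f \<Longrightarrow> finitary_smooth (neg_total_deriv \<mu> f)"
  by (simp add: neg_total_deriv_def finitary_smooth_minus finitary_smooth_total_deriv)

lemma neg_total_deriv_commute:
  "finitary_smooth f \<Longrightarrow>
    neg_total_deriv \<mu> (neg_total_deriv \<nu> f) = neg_total_deriv \<nu> (neg_total_deriv \<mu> f)"
  by (simp add: neg_total_deriv_def total_deriv_minus finitary_smooth_total_deriv
      total_deriv_commute[of f \<mu> \<nu>])

lemma finitary_smooth_foldr_neg_total_deriv: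
  "finitary_smooth f \<Longrightarrow> finitary_smooth (foldr neg_total_deriv xs f)"
  by (induction xs) (auto intro: finitary_smooth_neg_total_deriv)

lemma foldr_neg_total_deriv_swap:
  "finitary_smooth f \<Longrightarrow>
    foldr neg_total_deriv xs (neg_total_deriv \<mu> f) = neg_total_deriv \<mu> (foldr neg_total_deriv xs f)"
  by (induction xs)
     (auto simp: neg_total_deriv_commute[OF finitary_smooth_foldr_neg_total_deriv])

text \<open>The head of \<open>xs\<close> occurs somewhere in \<open>ys\<close> and can be moved to
  the front past the prefix \<open>us\<close> by commutation.\<close>

lemma foldr_neg_total_deriv_mset_cong:
  assumes "finitary_smooth f" "mset xs = mset ys"
  shows "foldr neg_total_deriv xs f = foldr neg_total_deriv ys f"
  using assms(2)
proof (induction xs arbitrary: ys)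
  case (Cons x xs)
  then have "x \<in> set ys" by (metis list.set_intros(1) mset_eq_setD)
  then obtain us vs where ys: "ys = us @ x # vs" by (meson split_list)
  have "foldr neg_total_deriv xs f = foldr neg_total_deriv (us @ vs) f"
    by (rule Cons.IH) (use Cons.prems ys in simp)
  then show ?case
    using foldr_neg_total_deriv_swap[OF finitary_smooth_foldr_neg_total_deriv[OF assms(1)], of us x vs]
    by (simp add: ys)
qed simp

text \<open>This is \<open>(- D)\<^sup>I\<close>. Total derivatives commute on smooth functions of finitely many coordinates, so
  on these the order chosen here is irrelevant.\<close>

definition adjoint_deriv :: "nat multiset \<Rightarrow> jet_fun \<Rightarrow> jet_fun" where
  "adjoint_deriv I = foldr neg_total_deriv (sorted_list_of_multiset I)"

lemma adjoint_deriv_empty [simp]: "adjoint_deriv {#} f = f"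
  and adjoint_deriv_single [simp]: "adjoint_deriv {#\<mu>#} f = neg_total_deriv \<mu> f"
  by (simp_all add: adjoint_deriv_def)

lemma adjoint_deriv_add_mset:
  assumes "finitary_smooth f"
  shows "adjoint_deriv (add_mset \<mu> I) f = adjoint_deriv I (neg_total_deriv \<mu> f)"
  using foldr_neg_total_deriv_mset_cong[OF assms,
      of "sorted_list_of_multiset (add_mset \<mu> I)" "sorted_list_of_multiset I @ [\<mu>]"]
  by (simp add: adjoint_deriv_def)

lemma adjoint_deriv_add:
  assumes "finitary_smooth f" "finitary_smooth g"
  shows "adjoint_deriv I (\<lambda>z. f z + g z) = (\<lambda>z. adjoint_deriv I f z + adjoint_deriv I g z)"
proof -
  have "foldr neg_total_deriv xs (\<lambda>z. f z + g z) =
      (\<lambda>z. foldr neg_total_deriv xs f z + foldr neg_total_deriv xs g z)" for xs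
    by (induction xs)
       (simp_all add: neg_total_deriv_def[of _ "\<lambda>z. foldr neg_total_deriv _ f z + foldr neg_total_deriv _ g z"]
         total_deriv_add finitary_smooth_foldr_neg_total_deriv assms, simp add: neg_total_deriv_def)
  then show ?thesis by (simp add: adjoint_deriv_def)
qed

lemma adjoint_deriv_zero: "adjoint_deriv I (\<lambda>_. 0) = (\<lambda>_. 0)"
proof -
  have "foldr neg_total_deriv xs (\<lambda>_. 0) = (\<lambda>_. 0)" for xs
    by (induction xs) (simp_all add: neg_total_deriv_def total_deriv_const)
  then show ?thesis by (simp add: adjoint_deriv_def)
qed

lemma adjoint_deriv_sum:
  assumes "\<And>a. a \<in> A \<Longrightarrow> finitary_smooth (f a)"
  shows "adjoint_deriv I (\<lambda>z. \<Sum>a\<in>A. f a z) = (\<lambda>z. \<Sum>a\<in>A. adjoint_deriv I (f a) z)"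
  using assms
  by (induction A rule: infinite_finite_induct)
     (simp_all add: adjoint_deriv_zero adjoint_deriv_add finitary_smooth_sum)

section \<open>The Euler operator annihilates divergences\<close>

definition derivative_indices :: "nat \<Rightarrow> nat \<Rightarrow> nat multiset set" where
  "derivative_indices d n = {I. set_mset I \<subseteq> {..<d} \<and> size I \<le> n}"

lemma finite_derivative_indices: "finite (derivative_indices d n)"
proof (rule finite_subset)
  show "derivative_indices d n \<subseteq> mset ` {xs. set xs \<subseteq> {..<d} \<and> length xs \<le> n}"
  proof
    fix I assume "I \<in> derivative_indices d n"
    moreover obtain xs where "I = mset xs" using ex_mset by metis
    ultimately show "I \<in> mset ` {xs. set xs \<subseteq> {..<d} \<and> length xs \<le> n}"
      by (auto simp: derivative_indices_def)
  qed
qed (simp add: finite_lists_length_le)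

text \<open>By the commutation rule for \<open>\<partial>/\<partial>v\<^sub>I\<close> and \<open>D\<^sub>\<mu>\<close>, the sum telescopes along \<open>I \<mapsto> I + {\<mu>}\<close>.\<close>

lemma euler_operator_total_deriv:
  assumes f: "finitary_smooth f" and \<mu>: "\<mu> < d"
    and n: "\<And>I. size I \<ge> n \<Longrightarrow> pderiv_at (Jet v I) f = (\<lambda>_. 0)"
  shows "(\<Sum>I\<in>derivative_indices d n. adjoint_deriv I (pderiv_at (Jet v I) (total_deriv \<mu> f)) z) = 0"
proof -
  let ?F = "derivative_indices d n"
  define a where "a I = adjoint_deriv (add_mset \<mu> I) (pderiv_at (Jet v I) f) z" for I
  have pf: "finitary_smooth (pderiv_at c f)" for c
    using f by (rule finitary_smooth_pderiv_at)
  have "adjoint_deriv I (pderiv_at (Jet v I) (total_deriv \<mu> f)) z =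
      (if \<mu> \<in># I then a (I - {#\<mu>#}) else 0) - a I" for I
  proof -
    have "adjoint_deriv I (\<lambda>z. if \<mu> \<in># I then pderiv_at (Jet v (I - {#\<mu>#})) f z else 0) z =
       (if \<mu> \<in># I then a (I - {#\<mu>#}) else 0)"
      by (simp add: a_def adjoint_deriv_zero)
    moreover have "adjoint_deriv I (total_deriv \<mu> (pderiv_at (Jet v I) f)) z = - a I"
    proof -
      \<comment> \<open>The function under \<open>adjoint_deriv I\<close> is identically zero, so
        additivity moves the minus sign of \<open>neg_total_deriv\<close> outside.\<close>
      have "adjoint_deriv I (\<lambda>z. neg_total_deriv \<mu> (pderiv_at (Jet v I) f) z
          + total_deriv \<mu> (pderiv_at (Jet v I) f) z) z = 0"
        by (simp add: neg_total_deriv_def adjoint_deriv_zero)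
      then show ?thesis
        by (simp add: adjoint_deriv_add finitary_smooth_neg_total_deriv finitary_smooth_total_deriv pf
            a_def adjoint_deriv_add_mset)
    qed
    moreover have "finitary_smooth (\<lambda>z. if \<mu> \<in># I then pderiv_at (Jet v (I - {#\<mu>#})) f z else 0)"
      using pf finitary_smooth_const by (cases "\<mu> \<in># I") simp_all
    ultimately show ?thesis
      by (simp add: pderiv_at_Jet_total_deriv f adjoint_deriv_add finitary_smooth_total_deriv pf)
  qed
  then have "(\<Sum>I\<in>?F. adjoint_deriv I (pderiv_at (Jet v I) (total_deriv \<mu> f)) z) =
      (\<Sum>I\<in>?F. if \<mu> \<in># I then a (I - {#\<mu>#}) else 0) - (\<Sum>I\<in>?F. a I)"
    by (simp add: sum_subtractf)
  also have "(\<Sum>I\<in>?F. if \<mu> \<in># I then a (I - {#\<mu>#}) else 0) = (\<Sum>I\<in>{I\<in>?F. \<mu> \<in># I}. a (I - {#\<mu>#}))"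
    by (simp add: sum.inter_filter finite_derivative_indices)
  \<comment> \<open>Removing one \<open>\<mu>\<close> lowers the size by one; the inverse map stays
    within the admissible indices because \<open>\<mu> < d\<close>.\<close>
  also have "\<dots> = (\<Sum>I\<in>{I\<in>?F. size I < n}. a I)"
  proof (rule sum.reindex_bij_witness[where i = "add_mset \<mu>" and j = "\<lambda>I. I - {#\<mu>#}"])
    fix I assume I: "I \<in> {I \<in> ?F. \<mu> \<in># I}"
    then have "size I > 0" by (auto simp: nonempty_has_size[symmetric])
    then show "I - {#\<mu>#} \<in> {I \<in> ?F. size I < n}"
      using I by (auto simp: derivative_indices_def size_Diff_singleton dest: in_diffD)
  qed (use \<mu> in \<open>auto simp: derivative_indices_def\<close>)
  \<comment> \<open>The indices of size \<open>n\<close> may be added, since \<open>f\<close> does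
    not depend on derivatives of \<open>v\<close> of that order.\<close>
  also have "\<dots> = (\<Sum>I\<in>?F. a I)"
  proof (rule sum.mono_neutral_left)
    show "\<forall>I\<in>?F - {I \<in> ?F. size I < n}. a I = 0"
    proof
      fix I assume "I \<in> ?F - {I \<in> ?F. size I < n}"
      then have "size I \<ge> n" by auto
      then show "a I = 0" by (simp add: a_def n adjoint_deriv_zero)
    qed
  qed (auto simp: finite_derivative_indices)
  finally show ?thesis by simp
qed

lemma jet_order_bound:
  assumes "finitary_smooth f"
  shows "\<exists>n. \<forall>I. size I \<ge> n \<longrightarrow> pderiv_at (Jet v I) f = (\<lambda>_. 0)"
proof -
  have "finite (size ` snd ` jet_support f)" using finite_jet_support[OF assms] by simp
  then obtain n where "\<forall>k\<in>size ` snd ` jet_support f. k < n"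
    using finite_nat_set_iff_bounded by blast
  then have "\<forall>I. size I \<ge> n \<longrightarrow> pderiv_at (Jet v I) f = (\<lambda>_. 0)"
    by (force simp: jet_support_def)
  then show ?thesis ..
qed

text \<open>The Euler operator annihilates each \<open>total_deriv \<mu> (\<beta> \<mu>)\<close>,
  whatever the order of \<open>\<beta> \<mu>\<close>. As \<open>Q\<close> is of first order in
  \<open>v\<close>, only indices of size 0 and 1 survive, which leaves the Euler-Lagrange equation
  as an identity on all of jet space.\<close>

lemma euler_lagrange_divergence:
  assumes \<beta>: "\<And>\<mu>. \<mu> < d \<Longrightarrow> finitary_smooth (\<beta> \<mu>)"
    and Q: "Q = (\<lambda>z. \<Sum>\<mu><d. total_deriv \<mu> (\<beta> \<mu>) z)"
    and first_order: "\<And>I. size I \<ge> 2 \<Longrightarrow> pderiv_at (Jet v I) Q = (\<lambda>_. 0)"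
  shows "pderiv_at (Jet v {#}) Q = (\<lambda>z. \<Sum>\<mu><d. total_deriv \<mu> (pderiv_at (Jet v {#\<mu>#}) Q) z)"
proof
  fix z
  have "\<exists>n. \<forall>\<mu><d. \<forall>I. size I \<ge> n \<longrightarrow> pderiv_at (Jet v I) (\<beta> \<mu>) = (\<lambda>_. 0)"
  proof -
    have "\<forall>\<mu>\<in>{..<d}. \<exists>n. \<forall>I. size I \<ge> n \<longrightarrow> pderiv_at (Jet v I) (\<beta> \<mu>) = (\<lambda>_. 0)"
      using jet_order_bound \<beta> by simp
    then obtain n where "\<forall>\<mu>\<in>{..<d}. \<forall>I. size I \<ge> n \<mu> \<longrightarrow> pderiv_at (Jet v I) (\<beta> \<mu>) = (\<lambda>_. 0)"
      by metis
    then have "\<forall>\<mu><d. \<forall>I. size I \<ge> Max (n ` {..<d}) \<longrightarrow> pderiv_at (Jet v I) (\<beta> \<mu>) = (\<lambda>_. 0)"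
      by (metis Max_ge finite_imageI finite_lessThan image_eqI lessThan_iff order_trans)
    then show ?thesis ..
  qed
  then obtain n0 where n0: "\<And>\<mu> I. \<mu> < d \<Longrightarrow> size I \<ge> n0 \<Longrightarrow> pderiv_at (Jet v I) (\<beta> \<mu>) = (\<lambda>_. 0)"
    by blast
  \<comment> \<open>The successor ensures that \<open>?F\<close> contains the singleton indices even
    when \<open>n0 = 0\<close>.\<close>
  define n where "n = Suc n0"
  let ?F = "derivative_indices d n"
  have D\<beta>: "finitary_smooth (total_deriv \<mu> (\<beta> \<mu>))" if "\<mu> < d" for \<mu>
    using \<beta> that by (intro finitary_smooth_total_deriv)
  have "adjoint_deriv I (pderiv_at (Jet v I) Q) z =
      (\<Sum>\<mu><d. adjoint_deriv I (pderiv_at (Jet v I) (total_deriv \<mu> (\<beta> \<mu>))) z)" for I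
  proof -
    have "pderiv_at (Jet v I) Q = (\<lambda>z. \<Sum>\<mu><d. pderiv_at (Jet v I) (total_deriv \<mu> (\<beta> \<mu>)) z)"
      unfolding Q by (rule pderiv_at_sum) (simp_all add: D\<beta>)
    moreover have "adjoint_deriv I (\<lambda>z. \<Sum>\<mu><d. pderiv_at (Jet v I) (total_deriv \<mu> (\<beta> \<mu>)) z) =
        (\<lambda>z. \<Sum>\<mu><d. adjoint_deriv I (pderiv_at (Jet v I) (total_deriv \<mu> (\<beta> \<mu>))) z)"
      by (rule adjoint_deriv_sum) (simp add: finitary_smooth_pderiv_at D\<beta>)
    ultimately show ?thesis by simp
  qed
  then have "(\<Sum>I\<in>?F. adjoint_deriv I (pderiv_at (Jet v I) Q) z) =
      (\<Sum>\<mu><d. \<Sum>I\<in>?F. adjoint_deriv I (pderiv_at (Jet v I) (total_deriv \<mu> (\<beta> \<mu>))) z)"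
    by (simp add: sum.swap[of _ "{..<d}"])
  also have "\<dots> = 0"
    using \<beta> n0 by (intro sum.neutral ballI euler_operator_total_deriv) (auto simp: n_def)
  finally have "0 = (\<Sum>I\<in>?F. adjoint_deriv I (pderiv_at (Jet v I) Q) z)" by simp
  also have "\<dots> = (\<Sum>I\<in>insert {#} ((\<lambda>\<mu>. {#\<mu>#}) ` {..<d}). adjoint_deriv I (pderiv_at (Jet v I) Q) z)"
  proof (rule sum.mono_neutral_right)
    show "\<forall>I\<in>?F - insert {#} ((\<lambda>\<mu>. {#\<mu>#}) ` {..<d}). adjoint_deriv I (pderiv_at (Jet v I) Q) z = 0"
    proof
      fix I assume I: "I \<in> ?F - insert {#} ((\<lambda>\<mu>. {#\<mu>#}) ` {..<d})"
      have "size I \<noteq> 0" using I by auto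
      moreover have "size I \<noteq> 1"
        using I by (auto simp: derivative_indices_def dest!: size_1_singleton_mset[unfolded One_nat_def])
      ultimately have "size I \<ge> 2" by linarith
      then show "adjoint_deriv I (pderiv_at (Jet v I) Q) z = 0"
        using first_order by (simp add: adjoint_deriv_zero)
    qed
  qed (simp_all add: finite_derivative_indices, auto simp: derivative_indices_def n_def)
  also have "\<dots> = pderiv_at (Jet v {#}) Q z + (\<Sum>\<mu><d. neg_total_deriv \<mu> (pderiv_at (Jet v {#\<mu>#}) Q) z)"
    by (subst sum.insert) (auto simp: sum.reindex inj_on_def)
  finally show "pderiv_at (Jet v {#}) Q z = (\<Sum>\<mu><d. total_deriv \<mu> (pderiv_at (Jet v {#\<mu>#}) Q) z)"
    by (simp add: neg_total_deriv_def sum_negf)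
qed

section \<open>The prolongation acting on the Lagrangian\<close>

text \<open>\<open>cov_deriv\<close> at a single spacetime index, with field values and derivatives
  as separate arguments. Neither the index nor \<open>d\<close> appears any more, which permits
  comparison between dimensions.\<close>

definition covariant_doublet ::
  "real \<Rightarrow> real \<Rightarrow> real \<Rightarrow> (nat \<Rightarrow> real) \<Rightarrow> (nat \<Rightarrow> real) \<Rightarrow> (nat \<Rightarrow> real) \<Rightarrow> real \<Rightarrow> nat \<Rightarrow> complex^2" where
  "covariant_doublet g g' Y \<phi> p w b n =
     doublet p n
     + (\<Sum>a=1..3. (\<i> * complex_of_real (g / 2 * w a)) *s (pauli a *v doublet \<phi> n))
     + (\<i> * complex_of_real (g' * Y * b)) *s doublet \<phi> n"

definition kinetic ::
  "nat \<Rightarrow> nat \<Rightarrow> real \<Rightarrow> real \<Rightarrow> real \<Rightarrow>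
   (nat \<Rightarrow> real) \<Rightarrow> (nat \<Rightarrow> real) \<Rightarrow> (nat \<Rightarrow> real) \<Rightarrow> real \<Rightarrow> real" where
  "kinetic N K g g' Y \<phi> p w b =
     (\<Sum>n=1..N. Re (hermitian_prod (covariant_doublet g g' Y \<phi> p w b n) (covariant_doublet g g' Y \<phi> p w b n)))
     + (\<Sum>m=1..K. 1 / 2 * p (4 * N + m) * p (4 * N + m))"

text \<open>Split off because it contains no scalar and is therefore untouched by scalar
  generators.\<close>

definition gauge_term :: "nat \<Rightarrow> real \<Rightarrow> jet_fun" where
  "gauge_term d g z =
     (\<Sum>\<mu><d. \<Sum>\<nu><d.
          1 / 4 * (\<Sum>a=1..3. W_strength g z a \<mu> \<nu> * (mink \<mu> * mink \<nu> * W_strength g z a \<mu> \<nu>))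
          + 1 / 4 * B_strength z \<mu> \<nu> * (mink \<mu> * mink \<nu> * B_strength z \<mu> \<nu>))"

lemma lagrangian_eq:
  "lagrangian d N K g g' Y V z =
     (\<Sum>\<mu><d. mink \<mu> * kinetic N K g g' Y (scalar z) (dscalar z \<mu>) (\<lambda>a. W_val z a \<mu>) (B_val z \<mu>))
     - V (scalar z) - gauge_term d g z"
  by (simp add: lagrangian_def kinetic_def gauge_term_def cov_deriv_def covariant_doublet_def
      sum_distrib_left distrib_left mult_ac)

text \<open>The real and imaginary parts of the two components are written out. Only sums, products
  and unary minus occur, to match \<open>finitary_smooth_intros\<close>.\<close>

lemma Re_hermitian_prod_covariant_doublet:
  fixes \<phi> p w :: "nat \<Rightarrow> real"
  defines "k \<equiv> 1 / sqrt 2"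
  shows "Re (hermitian_prod (covariant_doublet g g' Y \<phi> p w b n) (covariant_doublet g g' Y \<phi> p w b n)) =
   (let \<phi>1 = k * \<phi> (4*(n-1)+1); \<phi>2 = k * \<phi> (4*(n-1)+2); \<phi>3 = k * \<phi> (4*(n-1)+3); \<phi>4 = k * \<phi> (4*(n-1)+4);
        p1 = k * p (4*(n-1)+1); p2 = k * p (4*(n-1)+2); p3 = k * p (4*(n-1)+3); p4 = k * p (4*(n-1)+4);
        w1 = g / 2 * w 1; w2 = g / 2 * w 2; w3 = g / 2 * w 3; c = g' * Y * b;
        r1 = p1 + (- (w1 * \<phi>4)) + w2 * \<phi>3 + (- (w3 * \<phi>2)) + (- (c * \<phi>2));
        i1 = p2 + w1 * \<phi>3 + w2 * \<phi>4 + w3 * \<phi>1 + c * \<phi>1;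
        r2 = p3 + (- (w1 * \<phi>2)) + (- (w2 * \<phi>1)) + w3 * \<phi>4 + (- (c * \<phi>4));
        i2 = p4 + w1 * \<phi>1 + (- (w2 * \<phi>2)) + (- (w3 * \<phi>3)) + c * \<phi>3
    in r1 * r1 + i1 * i1 + r2 * r2 + i2 * i2)"
proof -
  have sum3: "(\<Sum>a=1..3. f a) = f 1 + f 2 + f 3" for f :: "nat \<Rightarrow> complex^2"
    by (simp add: numeral_3_eq_3 numeral_2_eq_2)
  have k: "1 / complex_of_real (sqrt 2) = complex_of_real k" by (simp add: k_def)
  show ?thesis
    unfolding covariant_doublet_def sum3
    by (simp add: hermitian_prod_def sum_2 pauli_def doublet_def k
        matrix_vector_mult_def Let_def del: of_real_divide)
       (simp add: algebra_simps)
qed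

lemma finitary_smooth_kinetic_field: "finitary_smooth (\<lambda>\<phi>. kinetic N K g g' Y \<phi> p w b)"
  and finitary_smooth_kinetic_derivative: "finitary_smooth (\<lambda>p. kinetic N K g g' Y \<phi> p w b)"
  unfolding kinetic_def Re_hermitian_prod_covariant_doublet Let_def
  by (intro finitary_smooth_intros)+

text \<open>All the squared quantities are linear in \<open>(p, w, b)\<close> for fixed
  \<open>\<phi>\<close>, so they merely change sign.\<close>

lemma kinetic_even: "kinetic N K g g' Y \<phi> (\<lambda>i. - p i) (\<lambda>a. - w a) (- b) = kinetic N K g g' Y \<phi> p w b"
proof -
  have square_eq: "x * x = y * y" if "x = - y" for x y :: real
    using that by simp
  show ?thesis
    unfolding kinetic_def Re_hermitian_prod_covariant_doublet Let_def
    by (intro arg_cong2[where f = "(+)"] sum.cong refl square_eq) (simp_all add: algebra_simps)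
qed

lemma kinetic_zero: "kinetic N K g g' Y \<phi> (\<lambda>_. 0) (\<lambda>_. 0) 0 = 0"
  by (simp add: kinetic_def Re_hermitian_prod_covariant_doublet)

text \<open>The summand of the prolonged Lagrangian belonging to one spacetime index, without its metric
  factor.\<close>

definition kinetic_variation ::
  "nat \<Rightarrow> nat \<Rightarrow> real \<Rightarrow> real \<Rightarrow> real \<Rightarrow> (nat \<Rightarrow> (nat \<Rightarrow> real) \<Rightarrow> real) \<Rightarrow>
   (nat \<Rightarrow> real) \<Rightarrow> (nat \<Rightarrow> real) \<Rightarrow> (nat \<Rightarrow> real) \<Rightarrow> real \<Rightarrow> real" where
  "kinetic_variation N K g g' Y \<eta> \<phi> p w b =
     (\<Sum>i=1..num_scalars N K. \<eta> i \<phi> * pderiv_at i (\<lambda>\<phi>. kinetic N K g g' Y \<phi> p w b) \<phi>)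
     + (\<Sum>i=1..num_scalars N K. \<Sum>j=1..num_scalars N K.
          p j * pderiv_at j (\<eta> i) \<phi> * pderiv_at i (\<lambda>p. kinetic N K g g' Y \<phi> p w b) p)"

definition potential_variation ::
  "nat \<Rightarrow> ((nat \<Rightarrow> real) \<Rightarrow> real) \<Rightarrow> (nat \<Rightarrow> (nat \<Rightarrow> real) \<Rightarrow> real) \<Rightarrow> (nat \<Rightarrow> real) \<Rightarrow> real" where
  "potential_variation n V \<eta> \<phi> = (\<Sum>i=1..n. \<eta> i \<phi> * pderiv_at i V \<phi>)"

lemma pderiv_at_reflect:
  assumes "smooth f"
  shows "pderiv_at c (\<lambda>p. f (\<lambda>i. - p i)) (\<lambda>i. - p i) = - pderiv_at c f p"
proof -
  have eq: "(\<lambda>i. - ((\<lambda>i. - p i)(c := t)) i) = p(c := - t)" for t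
    by auto
  have "((\<lambda>t. f (p(c := t))) has_real_derivative pderiv_at c f p) (at (- (- p c)))"
    using smooth_has_pderiv_at[OF assms] by simp
  then have "((\<lambda>t. f (p(c := - t))) has_real_derivative - pderiv_at c f p) (at (- p c))"
    by (simp add: DERIV_mirror)
  then show ?thesis
    unfolding pderiv_at_def[of c "\<lambda>p. f (\<lambda>i. - p i)"] eq by (rule DERIV_imp_deriv)
qed

text \<open>The first sum inherits evenness from \<open>kinetic\<close>. In the second, the
  derivative of an even function with respect to \<open>p\<close> is odd, and so is the factor
  \<open>p j\<close>.\<close>

lemma kinetic_variation_even:
  "kinetic_variation N K g g' Y \<eta> \<phi> (\<lambda>i. - p i) (\<lambda>a. - w a) (- b) = kinetic_variation N K g g' Y \<eta> \<phi> p w b"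
proof -
  have "(\<lambda>p'. kinetic N K g g' Y \<phi> p' (\<lambda>a. - w a) (- b)) = (\<lambda>p'. kinetic N K g g' Y \<phi> (\<lambda>i. - p' i) w b)"
    using kinetic_even[of N K g g' Y \<phi> "\<lambda>i. - _ i" w b] by simp
  then have "pderiv_at i (\<lambda>p'. kinetic N K g g' Y \<phi> p' (\<lambda>a. - w a) (- b)) (\<lambda>i. - p i)
      = - pderiv_at i (\<lambda>p. kinetic N K g g' Y \<phi> p w b) p" for i
    using pderiv_at_reflect[OF finitary_smooth_imp_smooth[OF finitary_smooth_kinetic_derivative], of i N K g g' Y \<phi> w b p]
    by simp
  then show ?thesis
    by (simp add: kinetic_variation_def kinetic_even)
qed

lemma kinetic_variation_zero: "kinetic_variation N K g g' Y \<eta> \<phi> (\<lambda>_. 0) (\<lambda>_. 0) 0 = 0"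
  by (simp add: kinetic_variation_def kinetic_zero)

lemma finitary_smooth_power: "finitary_smooth f \<Longrightarrow> finitary_smooth (\<lambda>z. f z ^ n)"
  by (induction n) (auto intro: finitary_smooth_const finitary_smooth_mult)

lemma finitary_smooth_prod:
  "(\<And>a. a \<in> A \<Longrightarrow> finitary_smooth (f a)) \<Longrightarrow> finitary_smooth (\<lambda>z. \<Prod>a\<in>A. f a z)"
  by (induction A rule: infinite_finite_induct)
     (auto simp: finitary_smooth_const finitary_smooth_mult)

lemma finitary_smooth_real_polynomial: "real_polynomial_in n V \<Longrightarrow> finitary_smooth V"
  unfolding real_polynomial_in_def
  by (elim exE conjE, simp only:)
     (intro finitary_smooth_intros finitary_smooth_power finitary_smooth_prod)

section \<open>Partial derivatives and prolongation of the Lagrangian\<close>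

lemma pderiv_at_lagrangian_field:
  assumes V: "smooth V"
  shows "pderiv_at (Jet (Scalar i) {#}) (lagrangian d N K g g' Y V) z =
    (\<Sum>\<mu><d. mink \<mu> * pderiv_at i (\<lambda>\<phi>. kinetic N K g g' Y \<phi> (dscalar z \<mu>) (\<lambda>a. W_val z a \<mu>) (B_val z \<mu>)) (scalar z))
    - pderiv_at i V (scalar z)"
proof -
  let ?c = "Jet (Scalar i) {#}"
  have sc: "scalar (z(?c := t)) = (scalar z)(i := t)" for t
    by auto
  have "gauge_term d g (z(?c := t)) = gauge_term d g z" for t
    by (simp add: gauge_term_def W_strength_def B_strength_def)
  then have "lagrangian d N K g g' Y V (z(?c := t)) =
     (\<Sum>\<mu><d. mink \<mu> * kinetic N K g g' Y ((scalar z)(i := t)) (dscalar z \<mu>) (\<lambda>a. W_val z a \<mu>) (B_val z \<mu>))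
     - V ((scalar z)(i := t)) - gauge_term d g z" for t
    unfolding lagrangian_eq sc by simp
  moreover have "((\<lambda>t. (\<Sum>\<mu><d. mink \<mu> * kinetic N K g g' Y ((scalar z)(i := t)) (dscalar z \<mu>) (\<lambda>a. W_val z a \<mu>) (B_val z \<mu>))
     - V ((scalar z)(i := t)) - gauge_term d g z) has_real_derivative
     (\<Sum>\<mu><d. mink \<mu> * pderiv_at i (\<lambda>\<phi>. kinetic N K g g' Y \<phi> (dscalar z \<mu>) (\<lambda>a. W_val z a \<mu>) (B_val z \<mu>)) (scalar z))
     - pderiv_at i V (scalar z) - 0) (at (scalar z i))"
    by (intro DERIV_diff DERIV_sum DERIV_cmult DERIV_const smooth_has_pderiv_at[OF V]
        smooth_has_pderiv_at[OF finitary_smooth_imp_smooth[OF finitary_smooth_kinetic_field]])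
  ultimately show ?thesis
    by (simp only: pderiv_at_def[of ?c] DERIV_imp_deriv diff_zero)
qed

lemma pderiv_at_lagrangian_derivative:
  assumes "\<mu> < d"
  shows "pderiv_at (Jet (Scalar i) {#\<mu>#}) (lagrangian d N K g g' Y V) z =
    mink \<mu> * pderiv_at i (\<lambda>p. kinetic N K g g' Y (scalar z) p (\<lambda>a. W_val z a \<mu>) (B_val z \<mu>)) (dscalar z \<mu>)"
proof -
  let ?c = "Jet (Scalar i) {#\<mu>#}"
  let ?k = "\<lambda>\<nu> p. kinetic N K g g' Y (scalar z) p (\<lambda>a. W_val z a \<nu>) (B_val z \<nu>)"
  \<comment> \<open>Only the kinetic summand at index \<open>\<mu>\<close> sees the changed
    coordinate.\<close>
  have sc: "dscalar (z(?c := t)) \<nu> = (if \<nu> = \<mu> then (dscalar z \<mu>)(i := t) else dscalar z \<nu>)" for t \<nu>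
    by auto
  have "gauge_term d g (z(?c := t)) = gauge_term d g z" for t
    by (simp add: gauge_term_def W_strength_def B_strength_def)
  then have "lagrangian d N K g g' Y V (z(?c := t)) =
     (\<Sum>\<nu><d. mink \<nu> * ?k \<nu> (if \<nu> = \<mu> then (dscalar z \<mu>)(i := t) else dscalar z \<nu>))
     - V (scalar z) - gauge_term d g z" for t
    unfolding lagrangian_eq sc by simp
  moreover have "((\<lambda>t. (\<Sum>\<nu><d. mink \<nu> * ?k \<nu> (if \<nu> = \<mu> then (dscalar z \<mu>)(i := t) else dscalar z \<nu>))
     - V (scalar z) - gauge_term d g z) has_real_derivative
     (\<Sum>\<nu><d. mink \<nu> * (if \<nu> = \<mu> then pderiv_at i (?k \<mu>) (dscalar z \<mu>) else 0)) - 0 - 0) (at (dscalar z \<mu> i))"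
  proof (intro DERIV_diff DERIV_sum DERIV_cmult DERIV_const)
    fix \<nu>
    show "((\<lambda>t. ?k \<nu> (if \<nu> = \<mu> then (dscalar z \<mu>)(i := t) else dscalar z \<nu>)) has_real_derivative
       (if \<nu> = \<mu> then pderiv_at i (?k \<mu>) (dscalar z \<mu>) else 0)) (at (dscalar z \<mu> i))"
      using smooth_has_pderiv_at[OF finitary_smooth_imp_smooth[OF finitary_smooth_kinetic_derivative]]
      by (cases "\<nu> = \<mu>") (simp_all del: fun_upd_apply)
  qed
  moreover have "(\<Sum>\<nu><d. mink \<nu> * (if \<nu> = \<mu> then pderiv_at i (?k \<mu>) (dscalar z \<mu>) else 0)) =
      mink \<mu> * pderiv_at i (?k \<mu>) (dscalar z \<mu>)"
    using assms by (simp add: if_distrib[of "\<lambda>x. _ * x"] cong: if_cong)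
  ultimately show ?thesis
    by (simp only: pderiv_at_def[of ?c] DERIV_imp_deriv diff_zero)
qed

text \<open>The gauge term drops out, and the rest splits into one summand per spacetime index plus
  the potential. The dimension enters only through the range of the sum.\<close>

lemma prolongation_lagrangian:
  assumes V: "smooth V"
  shows "prolongation d (num_scalars N K) \<eta> (lagrangian d N K g g' Y V) z =
    (\<Sum>\<mu><d. mink \<mu> * kinetic_variation N K g g' Y \<eta> (scalar z) (dscalar z \<mu>) (\<lambda>a. W_val z a \<mu>) (B_val z \<mu>))
    - potential_variation (num_scalars N K) V \<eta> (scalar z)"
proof -
  let ?n = "num_scalars N K"
  let ?k1 = "\<lambda>\<mu> i. pderiv_at i (\<lambda>\<phi>. kinetic N K g g' Y \<phi> (dscalar z \<mu>) (\<lambda>a. W_val z a \<mu>) (B_val z \<mu>)) (scalar z)"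
  let ?k2 = "\<lambda>\<mu> i. pderiv_at i (\<lambda>p. kinetic N K g g' Y (scalar z) p (\<lambda>a. W_val z a \<mu>) (B_val z \<mu>)) (dscalar z \<mu>)"
  have "(\<Sum>i=1..?n. \<eta> i (scalar z) * pderiv_at (Jet (Scalar i) {#}) (lagrangian d N K g g' Y V) z) =
    (\<Sum>i=1..?n. \<Sum>\<mu><d. mink \<mu> * (\<eta> i (scalar z) * ?k1 \<mu> i)) - potential_variation ?n V \<eta> (scalar z)"
    by (simp add: pderiv_at_lagrangian_field[OF V] potential_variation_def right_diff_distrib
        sum_subtractf sum_distrib_left mult_ac)
  moreover have "(\<Sum>\<mu><d. \<Sum>i=1..?n. \<Sum>j=1..?n.
          dscalar z \<mu> j * pderiv_at j (\<eta> i) (scalar z) * pderiv_at (Jet (Scalar i) {#\<mu>#}) (lagrangian d N K g g' Y V) z) =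
     (\<Sum>\<mu><d. mink \<mu> * (\<Sum>i=1..?n. \<Sum>j=1..?n. dscalar z \<mu> j * pderiv_at j (\<eta> i) (scalar z) * ?k2 \<mu> i))"
    by (simp add: pderiv_at_lagrangian_derivative sum_distrib_left mult_ac)
  ultimately show ?thesis
    unfolding prolongation_def kinetic_variation_def
    by (simp add: sum.swap[of _ "{..<d}"] sum_distrib_left distrib_left sum.distrib)
qed

section \<open>Dimension-free characterization of the symmetries\<close>

lemma local_function_imp_finitary_smooth: "local_function d N K f \<Longrightarrow> finitary_smooth f"
  by (auto simp: local_function_def finitary_smooth_def)

text \<open>Neither conclusion mentions \<open>d\<close>, so both carry over to every other
  dimension.\<close>

lemma variational_symmetry_imp:
  assumes V: "smooth V" and d: "d \<ge> 1" and sym: "variational_symmetry d N K g g' Y V \<eta>"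
  shows "kinetic_variation N K g g' Y \<eta> \<phi> p w b = 0"
    and "potential_variation (num_scalars N K) V \<eta> \<phi> = potential_variation (num_scalars N K) V \<eta> \<phi>'"
proof -
  let ?P = "kinetic_variation N K g g' Y \<eta>" and ?U = "potential_variation (num_scalars N K) V \<eta>"
  define Q where "Q = prolongation d (num_scalars N K) \<eta> (lagrangian d N K g g' Y V)"
  have Q: "Q z = (\<Sum>\<mu><d. mink \<mu> * ?P (scalar z) (dscalar z \<mu>) (\<lambda>a. W_val z a \<mu>) (B_val z \<mu>)) - ?U (scalar z)" for z
    by (simp add: Q_def prolongation_lagrangian[OF V])
  obtain \<beta> where \<beta>: "\<And>\<mu>. \<mu> < d \<Longrightarrow> finitary_smooth (\<beta> \<mu>)"
    and Q\<beta>: "Q = (\<lambda>z. \<Sum>\<mu><d. total_deriv \<mu> (\<beta> \<mu>) z)"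
    using sym local_function_imp_finitary_smooth unfolding variational_symmetry_def Q_def by blast
  have Qs: "finitary_smooth Q"
    unfolding Q\<beta> using \<beta> by (intro finitary_smooth_sum finitary_smooth_total_deriv) simp
  define C where "C = (\<Union>i. {Jet (Scalar i) {#}}) \<union> (\<Union>i \<mu>. {Jet (Scalar i) {#\<mu>#}})
    \<union> (\<Union>a \<mu>. {Jet (WField a \<mu>) {#}}) \<union> (\<Union>\<mu>. {Jet (BField \<mu>) {#}})"
  have "depends_only_on C Q"
    unfolding depends_only_on_def
  proof (intro allI impI)
    fix z z' :: "jet_coord \<Rightarrow> real" assume "\<forall>c\<in>C. z c = z' c"
    then have "scalar z = scalar z'" "\<And>\<mu>. dscalar z \<mu> = dscalar z' \<mu>" 
      "\<And>a \<mu>. W_val z a \<mu> = W_val z' a \<mu>" "\<And>\<mu>. B_val z \<mu> = B_val z' \<mu>"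
      by (auto simp: C_def)
    then show "Q z = Q z'" unfolding Q by simp
  qed
  note absent = depends_only_on_pderiv_at(2)[OF this]
  have second_order: "pderiv_at (Jet v I) Q = (\<lambda>_. 0)" if "size I \<ge> 2" for v I
    by (rule absent) (use that in \<open>auto simp: C_def\<close>)
  note euler = euler_lagrange_divergence[OF \<beta> Q\<beta> second_order]
  \<comment> \<open>\<open>Q\<close> contains no derivative of a gauge field, so the right-hand side
    of the Euler-Lagrange equation is zero.\<close>
  have gauge: "pderiv_at (Jet v {#}) Q = (\<lambda>_. 0)" if "v \<notin> range Scalar" for v
  proof -
    have "pderiv_at (Jet v {#\<mu>#}) Q = (\<lambda>_. 0)" for \<mu>
      by (rule absent) (use that in \<open>auto simp: C_def\<close>)
    then show ?thesis
      by (subst euler) (simp_all add: total_deriv_const)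
  qed
  have pQ: "finitary_smooth (pderiv_at c Q)" for c
    using Qs by (rule finitary_smooth_pderiv_at)
  note comm = pderiv_at_commute[OF finitary_smooth_imp_smooth[OF Qs]]
  \<comment> \<open>The Euler-Lagrange equation is differentiated with respect to
    \<open>Jet (Scalar j) {#0, 0#}\<close>. Its left side does not contain this coordinate; on the
    right the commutation rule leaves a term only for \<open>\<mu> = 0\<close>, the one index
    occurring in \<open>{#0, 0#}\<close>.\<close>
  have momentum: "pderiv_at (Jet (Scalar j) {#0#}) (pderiv_at (Jet (Scalar i) {#0#}) Q) = (\<lambda>_. 0)" for i j
  proof
    fix z
    let ?c = "Jet (Scalar j) {#0, 0#}"
    have c0: "pderiv_at ?c (pderiv_at c Q) = (\<lambda>_. 0)" for c
      by (subst comm) (simp add: second_order)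
    have "0 = pderiv_at ?c (pderiv_at (Jet (Scalar i) {#}) Q) z"
      by (simp add: c0)
    also have "\<dots> = (\<Sum>\<mu><d. pderiv_at ?c (total_deriv \<mu> (pderiv_at (Jet (Scalar i) {#\<mu>#}) Q)) z)"
      by (subst euler) (simp_all add: pderiv_at_sum finitary_smooth_total_deriv pQ)
    also have "\<dots> = (\<Sum>\<mu><d. if \<mu> = 0 then pderiv_at (Jet (Scalar j) {#0#}) (pderiv_at (Jet (Scalar i) {#0#}) Q) z else 0)"
      by (intro sum.cong refl) (simp add: pderiv_at_Jet_total_deriv pQ c0 total_deriv_const)
    also have "\<dots> = pderiv_at (Jet (Scalar j) {#0#}) (pderiv_at (Jet (Scalar i) {#0#}) Q) z"
      using d by (simp add: sum.delta)
    finally show "pderiv_at (Jet (Scalar j) {#0#}) (pderiv_at (Jet (Scalar i) {#0#}) Q) z = 0"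
      by simp
  qed
  \<comment> \<open>These are the coordinates entering the summand \<open>\<mu> = 0\<close> of
    \<open>Q\<close> through the last three arguments of \<open>?P\<close>.\<close>
  define T where "T = (\<Union>i. {Jet (Scalar i) {#0#}}) \<union> (\<Union>a. {Jet (WField a 0) {#}}) \<union> {Jet (BField 0) {#}}"
  \<comment> \<open>A gauge coordinate makes the second derivative vanish by \<open>gauge\<close>,
    after an exchange if it belongs to the outer derivative; otherwise \<open>momentum\<close>
    applies.\<close>
  have TT: "pderiv_at c (pderiv_at c' Q) = (\<lambda>_. 0)" if cc': "c \<in> T" "c' \<in> T" for c c'
  proof -
    consider v where "c = Jet v {#}" "v \<notin> range Scalar" | v where "c' = Jet v {#}" "v \<notin> range Scalar"
      | i j where "c = Jet (Scalar i) {#0#}" "c' = Jet (Scalar j) {#0#}"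
      using cc' unfolding T_def by auto
    then show ?thesis
    proof cases
      case 1
      then show ?thesis by (subst comm) (simp add: gauge)
    qed (simp_all add: gauge momentum)
  qed
  show P0: "?P \<phi> p w b = 0" for \<phi> p w b
  proof -
    \<comment> \<open>This point realizes the given arguments at spacetime index 0 and has zero
      scalar derivatives and gauge fields at all other indices.\<close>
    define z where "z c = (case c of Pos _ \<Rightarrow> 0
      | Jet (Scalar i) I \<Rightarrow> if I = {#} then \<phi> i else if I = {#0#} then p i else 0
      | Jet (WField a \<mu>) I \<Rightarrow> if I = {#} \<and> \<mu> = 0 then w a else 0
      | Jet (BField \<mu>) I \<Rightarrow> if I = {#} \<and> \<mu> = 0 then b else 0)" for c
    \<comment> \<open>The factors 1, -1 and 0 give the three points of the affine identity;
      \<open>R\<close> collects what does not depend on \<open>s\<close>.\<close>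
    define m where "m s c = (if c \<in> T then s * z c else z c)" for s c
    define R where "R = (\<Sum>\<mu>\<in>{1..<d}. mink \<mu> * ?P \<phi> (\<lambda>_. 0) (\<lambda>_. 0) 0) - ?U \<phi>"
    have Qm: "Q (m s) = ?P \<phi> (\<lambda>i. s * p i) (\<lambda>a. s * w a) (s * b) + R" for s
    proof -
      have "{..<d} = insert 0 {1..<d}" using d by auto
      moreover have "?P (scalar (m s)) (dscalar (m s) \<mu>) (\<lambda>a. W_val (m s) a \<mu>) (B_val (m s) \<mu>) = ?P \<phi> (\<lambda>_. 0) (\<lambda>_. 0) 0"
        if "\<mu> \<noteq> 0" for \<mu>
        using that by (simp add: m_def z_def T_def)
      ultimately show ?thesis
        by (simp add: Q R_def) (simp add: m_def z_def T_def mink_def)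
    qed
    \<comment> \<open>By evenness the left side is \<open>2 * ?P \<phi> p w b + 2 * R\<close>, and
      since \<open>?P\<close> vanishes at zero arguments the right side is
      \<open>2 * R\<close>.\<close>
    have "Q (m 1) + Q (m (-1)) = 2 * Q (m 0)"
      using affine_if_second_pderivs_zero[where T = T and z = z, OF Qs TT]
      by (simp add: m_def[abs_def] cong: if_cong)
    then show ?thesis
      by (simp add: Qm kinetic_variation_even kinetic_variation_zero)
  qed
  have QU: "Q z = - ?U (scalar z)" for z
    by (simp add: Q P0)
  have "depends_only_on (\<Union>i. {Jet (Scalar i) {#}}) Q"
    unfolding depends_only_on_def QU by (auto intro!: arg_cong[where f = ?U])
  note absent' = depends_only_on_pderiv_at(2)[OF this]
  \<comment> \<open>Now \<open>Q\<close> contains no derivatives of the scalars either, so the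
    right-hand side of their Euler-Lagrange equations vanishes.\<close>
  have field: "pderiv_at (Jet (Scalar i) {#}) Q = (\<lambda>_. 0)" for i
    by (subst euler) (simp_all add: absent' total_deriv_const)
  have "pderiv_at c Q = (\<lambda>_. 0)" for c
    using field absent' by (cases "c \<in> (\<Union>i. {Jet (Scalar i) {#}})") auto
  note const = eq_if_pderivs_zero[where T = UNIV, OF Qs this]
  \<comment> \<open>Any jet point with prescribed undifferentiated scalars would do; here the
    derivatives of a scalar get the same value as the scalar.\<close>
  define emb where "emb \<phi> c = (case c of Jet (Scalar i) I \<Rightarrow> \<phi> i | _ \<Rightarrow> (0::real))" for \<phi> :: "nat \<Rightarrow> real" and c
  have "Q (emb \<phi>) = Q (emb \<phi>')"
    by (rule const) simp
  then show "?U \<phi> = ?U \<phi>'"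
    by (simp add: QU emb_def)
qed

text \<open>The prolonged Lagrangian is the constant \<open>- k\<close>, the total derivative of
  \<open>- k * z (Pos 0)\<close> in direction 0. The coordinate \<open>Pos 0\<close> is available
  because \<open>d \<ge> 1\<close>.\<close>

lemma variational_symmetryI:
  assumes V: "smooth V" and d: "d \<ge> 1"
    and P: "\<And>\<phi> p w b. kinetic_variation N K g g' Y \<eta> \<phi> p w b = 0"
    and U: "\<And>\<phi>. potential_variation (num_scalars N K) V \<eta> \<phi> = k"
  shows "variational_symmetry d N K g g' Y V \<eta>"
  unfolding variational_symmetry_def
proof (intro exI conjI allI impI)
  let ?\<beta> = "\<lambda>\<mu> z. (if \<mu> = 0 then - k else 0) * z (Pos 0)"
  fix \<mu> assume "\<mu> < d"
  have "depends_only_on {Pos 0} (?\<beta> \<mu>)"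
    by (simp add: depends_only_on_def)
  moreover have "{Pos 0} \<subseteq> jet_coords d N K"
    using d by (auto simp: jet_coords_def)
  ultimately show "local_function d N K (?\<beta> \<mu>)"
    unfolding local_function_def
    using smooth_mult[OF smooth_const smooth_coord, of "if \<mu> = 0 then - k else 0" "Pos 0"] by blast
next
  fix z
  let ?\<beta> = "\<lambda>\<mu> z. (if \<mu> = 0 then - k else 0) * z (Pos 0)"
  have "total_deriv \<mu> (?\<beta> \<mu>) z = (if \<mu> = 0 then - k else 0)" for \<mu>
    by (simp add: total_deriv_mult[OF finitary_smooth_const finitary_smooth_coord] total_deriv_const total_deriv_Pos)
  then have "(\<Sum>\<mu><d. total_deriv \<mu> (?\<beta> \<mu>) z) = - k"
    using d by (simp add: sum.delta)
  then show "prolongation d (num_scalars N K) \<eta> (lagrangian d N K g g' Y V) z = (\<Sum>\<mu><d. total_deriv \<mu> (?\<beta> \<mu>) z)"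
    by (simp add: prolongation_lagrangian[OF V] P U)
qed

theorem proposition1:
  fixes N K :: nat and g g' Y :: real
    and V :: "(nat \<Rightarrow> real) \<Rightarrow> real"
    and \<eta> :: "nat \<Rightarrow> (nat \<Rightarrow> real) \<Rightarrow> real"
  assumes "N \<ge> 1"
    and "real_polynomial_in (num_scalars N K) V"
    and "scalar_generator (num_scalars N K) \<eta>"
  shows "(\<exists>d\<ge>1. variational_symmetry d N K g g' Y V \<eta>) \<longleftrightarrow>
         (\<forall>d\<ge>1. variational_symmetry d N K g g' Y V \<eta>)"
proof
  have V: "smooth V"
    using assms(2) by (intro finitary_smooth_imp_smooth finitary_smooth_real_polynomial)
  assume "\<exists>d\<ge>1. variational_symmetry d N K g g' Y V \<eta>"
  then obtain d where d: "d \<ge> 1" "variational_symmetry d N K g g' Y V \<eta>" by blast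
  show "\<forall>d\<ge>1. variational_symmetry d N K g g' Y V \<eta>"
    \<comment> \<open>The constant \<open>k\<close> is the value of the potential variation at an
      arbitrary fixed point.\<close>
    using variational_symmetryI[OF V _ variational_symmetry_imp[OF V d]] by blast
qed blast

end
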